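(* Let $q$ be a complex number with $0<|q|<1$. Then the following five identities hold: \begin{align*} \sum_{i,j,k\ge 0}\frac{q^{i^2+3j^2+8k^2+2ij+4ik+8jk-j}}{(q^2;q^2)_i(q^2;q^2)_j(q^4;q^4)_k} &= \frac{1}{(q,q^4,q^7;q^8)_\infty},\\ \sum_{i,j,k\ge 0}\frac{q^{i^2+3j^2+8k^2+2ij+4ik+8jk+i-3j-4k}}{(q^2;q^2)_i(q^2;q^2)_j(q^4;q^4)_k} &=2\,\frac{(q^8;q^8)_\infty}{(q^2;q^2)_\infty},\\ \sum_{i,j,k\ge 0}\frac{q^{i^2+3j^2+8k^2+2ij+4ik+8jk+i-j}}{(q^2;q^2)_i(q^2;q^2)_j(q^4;q^4)_k} &= \frac{(q^4;q^4)^3_\infty}{(q^2;q^2)^2_\infty(q^8;q^8)_\infty},\\ \sum_{i,j,k\ge 0}\frac{q^{i^2+3j^2+8k^2+2ij+4ik+8jk+i+j+4k}}{(q^2;q^2)_i(q^2;q^2)_j(q^4;q^4)_k} &=\frac{(q^8;q^8)_\infty}{(q^2;q^2)_\infty},\\ \sum_{i,j,k\ge 0}\frac{q^{i^2+3j^2+8k^2+2ij+4ik+8jk+2i+j+4k}}{(q^2;q^2)_i(q^2;q^2)_j(q^4;q^4)_k} &=\frac{1}{(q^3,q^4,q^5;q^8)_\infty}. \end{align*}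
   Context: For $|q|<1$: $(a;q)_\infty=\prod_{m=0}^\infty(1-aq^m)$, $(a;q)_n=(a;q)_\infty/(aq^n;q)_\infty=\prod_{m=0}^{n-1}(1-aq^m)$ for integers $n\ge0$, and $(a_1,\dots,a_r;q)_\infty=(a_1;q)_\infty\cdots(a_r;q)_\infty$; the same notation is used with the base $q$ replaced by a power of $q$. *)

theory Defs
  imports "HOL-Analysis.Analysis"
begin

text \<open>
  The q-Pochhammer symbols \<open>(a;q)\<^sub>n\<close>, \<open>(a;q)\<^sub>\<infinity>\<close> and \<open>(a\<^sub>1,\<dots>,a\<^sub>r;q)\<^sub>\<infinity>\<close>.
  The infinite product converges when \<open>norm q < 1\<close>, with value \<open>0\<close> if a factor
  vanishes; outside that range \<open>qpoch_inf\<close> carries no intended meaning.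
\<close>

definition qpoch :: "complex \<Rightarrow> complex \<Rightarrow> nat \<Rightarrow> complex" where
  "qpoch a q n = (\<Prod>m<n. 1 - a * q ^ m)"

definition qpoch_inf :: "complex \<Rightarrow> complex \<Rightarrow> complex" where
  "qpoch_inf a q = (\<Prod>m. 1 - a * q ^ m)"

definition qpoch_inf_list :: "complex list \<Rightarrow> complex \<Rightarrow> complex" where
  "qpoch_inf_list as q = prod_list (map (\<lambda>a. qpoch_inf a q) as)"

text \<open>
  The summand common to all five sums; \<open>a\<close>, \<open>b\<close>, \<open>c\<close> are the coefficients of the linear
  terms \<open>a i + b j + c k\<close> in the exponent. They may be negative, hence the integer power.
\<close>

definition summand :: "complex \<Rightarrow> int \<Rightarrow> int \<Rightarrow> int \<Rightarrow> nat \<times> nat \<times> nat \<Rightarrow> complex" where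
  "summand q a b c = (\<lambda>(i, j, k).
     q powi ((int i)^2 + 3 * (int j)^2 + 8 * (int k)^2
             + 2 * int i * int j + 4 * int i * int k + 8 * int j * int k
             + a * int i + b * int j + c * int k)
     / (qpoch (q^2) (q^2) i * qpoch (q^2) (q^2) j * qpoch (q^4) (q^4) k))"

end

theory Submission
  imports Defs
begin

text \<open>
  The quadratic form diagonalises over the integers: with \<open>n = j + 2 k\<close> and \<open>N = i + n\<close> it equals
  \<open>N\<^sup>2 + n\<^sup>2 + j\<^sup>2\<close>, and in each of the five cases the linear part is \<open>a N + d n - j\<close> for suitable
  integers \<open>a\<close> and \<open>d\<close>. Hence the two inner summations can be carried out in closed form. For fixed \<open>n\<close>
  the sum over \<open>j + 2 k = n\<close> is \<open>1/(q\<^sup>2;q\<^sup>2)\<^sub>n\<close> (\<open>rqfac_even_odd_sum\<close>), a form of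
  \<open>(-z;q\<^sup>2)\<^sub>\<infinity> (z;q\<^sup>2)\<^sub>\<infinity> = (z\<^sup>2;q\<^sup>4)\<^sub>\<infinity>\<close>. For fixed \<open>N\<close> the sum over \<open>n\<close> is then the finite q-binomial
  theorem (\<open>qbinomial_sum\<close>). The triple sum becomes (\<open>triple_sum_reduction\<close>)
  \<open>\<Sum>N. q powi (N\<^sup>2 + a N) (-q\<^sup>1\<^sup>+\<^sup>d;q\<^sup>2)\<^sub>N / (q\<^sup>2;q\<^sup>2)\<^sub>N\<close>.

  For \<open>a = 1\<close>, which covers the three middle identities, this is Lebesgue's series
  (\<open>lebesgue_identity\<close>). It is evaluated through a first-order functional equation in its parameter,
  obtained by telescoping, together with Euler's expansion of an infinite product.

  For \<open>d = 0\<close> and \<open>a = 0\<close> or \<open>a = 2\<close> the single sums are those of the two Goellnitz-Gordon identities,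
  proved here by Bailey's method in base \<open>Q = q\<^sup>2\<close>. Both \<open>1/(Q;Q)\<^sub>n\<close> and \<open>Q\<^sup>n/(Q;Q)\<^sub>n\<close> are finite bilateral
  sums of alternating powers of \<open>q\<close> against the kernel \<open>1/((Q;Q)\<^sub>n\<^sub>-\<^sub>r (Q;Q)\<^sub>n\<^sub>+\<^sub>r)\<close>
  (\<open>bailey_pair_1\<close>, \<open>bailey_pair_2\<close>). These follow from the symmetries \<open>r \<mapsto> -r\<close> and
  \<open>r \<mapsto> 1 - r\<close> alone. Summing the kernel against \<open>(-q;Q)\<^sub>n q powi n\<^sup>2\<close> gives a power of \<open>q\<close> with exponent
  \<open>r\<^sup>2\<close>, up to a constant factor (\<open>gg_weight_kernel_sum\<close>). After interchanging the summations there remain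
  the theta series \<open>\<Sum>r. (-1)\<^sup>r q powi (4 r\<^sup>2 - r)\<close> and \<open>\<Sum>r. (-1)\<^sup>r q powi (4 r\<^sup>2 - 3 r)\<close>, which the Jacobi
  triple product turns into infinite products with base \<open>q\<^sup>8\<close>.
\<close>

section \<open>Infinite q-products\<close>

lemma qpoch_0 [simp]: "qpoch a q 0 = 1"
  by (simp add: qpoch_def)

lemma qpoch_Suc: "qpoch a q (Suc n) = qpoch a q n * (1 - a * q ^ n)"
  by (simp add: qpoch_def)

lemma qpoch_Suc_shift: "qpoch a q (Suc n) = (1 - a) * qpoch (a * q) q n"
  by (simp only: qpoch_def prod.lessThan_Suc_shift) (simp add: mult_ac)

lemma convergent_prod_qpoch:
  fixes a q :: complex
  assumes "norm q < 1"
  shows "convergent_prod (\<lambda>m. 1 - a * q ^ m)"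
proof -
  have "summable (\<lambda>m. norm (- (a * q ^ m)))"
    using assms by (simp add: norm_mult norm_power summable_mult summable_geometric)
  then have "abs_convergent_prod (\<lambda>m. 1 + (- (a * q ^ m)))"
    by (intro summable_imp_abs_convergent_prod) simp
  then show ?thesis
    by (simp add: abs_convergent_prod_imp_convergent_prod)
qed

lemma qpoch_LIMSEQ:
  assumes "norm q < 1"
  shows "qpoch a q \<longlonglongrightarrow> qpoch_inf a q"
proof -
  have "(\<lambda>n. \<Prod>m\<le>n. 1 - a * q ^ m) \<longlonglongrightarrow> qpoch_inf a q"
    unfolding qpoch_inf_def by (rule convergent_prod_LIMSEQ[OF convergent_prod_qpoch[OF assms]])
  then show ?thesis
    by (subst (asm) LIMSEQ_lessThan_iff_atMost[symmetric]) (simp add: qpoch_def[abs_def])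
qed

lemma one_minus_mult_power_nonzero:
  fixes a q :: complex
  assumes "norm q < 1" "norm a < 1"
  shows "1 - a * q ^ m \<noteq> 0"
proof
  assume "1 - a * q ^ m = 0"
  then have "norm (a * q ^ m) = 1"
    by (metis eq_iff_diff_eq_0 norm_one)
  moreover have "norm a * norm q ^ m \<le> norm a * 1"
    using assms by (intro mult_left_mono power_le_one) auto
  ultimately show False
    using assms by (simp add: norm_mult norm_power)
qed

lemma qpoch_inf_nonzero:
  assumes "norm q < 1" "norm a < 1"
  shows "qpoch_inf a q \<noteq> 0"
  unfolding qpoch_inf_def
  by (rule prodinf_nonzero[OF convergent_prod_qpoch]) (use one_minus_mult_power_nonzero assms in auto)

lemma qpoch_inf_rec:
  assumes "norm q < 1"
  shows "qpoch_inf a q = (1 - a) * qpoch_inf (a * q) q"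
proof (rule LIMSEQ_unique)
  show "(\<lambda>n. qpoch a q (Suc n)) \<longlonglongrightarrow> qpoch_inf a q"
    using qpoch_LIMSEQ[OF assms] by (rule LIMSEQ_Suc)
  show "(\<lambda>n. qpoch a q (Suc n)) \<longlonglongrightarrow> (1 - a) * qpoch_inf (a * q) q"
    unfolding qpoch_Suc_shift by (intro tendsto_intros qpoch_LIMSEQ assms)
qed

lemma qpoch_inf_dissect:
  assumes "norm q < 1"
  shows "qpoch_inf a q = qpoch_inf a (q^2) * qpoch_inf (a * q) (q^2)"
proof (rule LIMSEQ_unique)
  have q2: "norm (q^2) < 1"
    using assms by (simp add: norm_power power_less_one_iff)
  have "qpoch a q (2 * n) = qpoch a (q^2) n * qpoch (a * q) (q^2) n" for n
    by (induction n) (simp_all add: qpoch_Suc power_mult[symmetric] mult_ac)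
  then show "(\<lambda>n. qpoch a q (2 * n)) \<longlonglongrightarrow> qpoch_inf a (q^2) * qpoch_inf (a * q) (q^2)"
    by (simp only:) (intro tendsto_intros qpoch_LIMSEQ q2)
  show "(\<lambda>n. qpoch a q (2 * n)) \<longlonglongrightarrow> qpoch_inf a q"
    using LIMSEQ_subseq_LIMSEQ[OF qpoch_LIMSEQ[OF assms], of "\<lambda>n. 2 * n" a]
    by (simp add: strict_mono_def o_def)
qed

lemma qpoch_inf_mult_minus:
  assumes "norm q < 1"
  shows "qpoch_inf a q * qpoch_inf (- a) q = qpoch_inf (a^2) (q^2)"
proof (rule LIMSEQ_unique)
  have q2: "norm (q^2) < 1"
    using assms by (simp add: norm_power power_less_one_iff)
  have "qpoch a q n * qpoch (- a) q n = qpoch (a^2) (q^2) n" for n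
    unfolding qpoch_def prod.distrib[symmetric]
    by (intro prod.cong) (auto simp: power_mult[symmetric] power2_eq_square algebra_simps power_mult_distrib)
  then show "(\<lambda>n. qpoch a q n * qpoch (- a) q n) \<longlonglongrightarrow> qpoch_inf (a^2) (q^2)"
    by (simp only:) (intro qpoch_LIMSEQ q2)
  show "(\<lambda>n. qpoch a q n * qpoch (- a) q n) \<longlonglongrightarrow> qpoch_inf a q * qpoch_inf (- a) q"
    by (intro tendsto_intros qpoch_LIMSEQ assms)
qed

lemma qpoch_bounded:
  assumes "norm q < 1"
  obtains C where "C > 0" "\<And>n. norm (qpoch a q n) \<le> C"
  using convergent_imp_Bseq[of "qpoch a q"] qpoch_LIMSEQ[OF assms]
  unfolding Bseq_def convergent_def by blast

section \<open>Reciprocal q-factorials\<close>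

text \<open>
  The value \<open>0\<close> at negative integers is the usual convention for \<open>1/(q;q)\<^sub>m\<close>. With it the recurrence
  \<open>rqfac_rec\<close> holds for every integer \<open>m\<close>, in particular for \<open>m = 0\<close>, so that shifts of summation indices
  produce no boundary terms.
\<close>

definition rqfac :: "complex \<Rightarrow> int \<Rightarrow> complex" where
  "rqfac q m = (if m < 0 then 0 else 1 / qpoch q q (nat m))"

lemma rqfac_neg [simp]: "m < 0 \<Longrightarrow> rqfac q m = 0"
  by (simp add: rqfac_def)

lemma rqfac_0 [simp]: "rqfac q 0 = 1"
  by (simp add: rqfac_def)

lemma rqfac_of_nat: "rqfac q (int n) = 1 / qpoch q q n"
  by (simp add: rqfac_def)

lemma rqfac_rec:
  assumes "norm q < 1"
  shows "(1 - q powi m) * rqfac q m = rqfac q (m - 1)"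
proof (cases "m \<le> 0")
  case True
  then show ?thesis by (cases "m = 0") auto
next
  case False
  then obtain k where k: "m = int (Suc k)"
    by (metis gr0_conv_Suc not_le zero_less_imp_eq_int)
  have "1 - q * q ^ k \<noteq> 0"
    by (rule one_minus_mult_power_nonzero) (use assms in auto)
  moreover have "q powi (int (Suc k)) = q * q ^ k"
    by (simp only: power_int_of_nat power_Suc)
  moreover have "rqfac q (int (Suc k) - 1) = rqfac q (int k)"
    by simp
  ultimately show ?thesis
    unfolding k rqfac_of_nat by (simp only: rqfac_of_nat qpoch_Suc) simp
qed

lemma rqfac_LIMSEQ:
  assumes "norm q < 1"
  shows "(\<lambda>n. rqfac q (int n)) \<longlonglongrightarrow> 1 / qpoch_inf q q"
  unfolding rqfac_of_nat
  by (intro tendsto_intros qpoch_LIMSEQ qpoch_inf_nonzero assms)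

lemma rqfac_bounded:
  assumes "norm q < 1"
  obtains C where "C > 0" "\<And>m. norm (rqfac q m) \<le> C"
proof -
  have "Bseq (\<lambda>n. rqfac q (int n))"
    using rqfac_LIMSEQ[OF assms] convergent_imp_Bseq convergent_def by blast
  then obtain C where C: "C > 0" "\<And>n. norm (rqfac q (int n)) \<le> C"
    unfolding Bseq_def by blast
  have "norm (rqfac q m) \<le> C" for m
    using C(2)[of "nat m"] C(1) by (cases "m < 0") auto
  with C(1) that show ?thesis by blast
qed

text \<open>
  The finite q-binomial theorem in base \<open>Q = q\<^sup>2\<close>. If \<open>S N\<close> is the left-hand side, then splitting
  \<open>1 - Q\<^sup>N = (1 - Q\<^sup>N\<^sup>-\<^sup>n) + Q\<^sup>N\<^sup>-\<^sup>n (1 - Q\<^sup>n)\<close> inside the sum and cancelling one factor of a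
  q-factorial in each part gives \<open>(1 - Q\<^sup>N) S N = (1 + x q powi (2 N - 1)) S (N - 1)\<close>.
\<close>

lemma qbinomial_sum:
  fixes q x :: complex
  assumes "norm q < 1"
  shows "(\<Sum>n\<le>N. x ^ n * q ^ n\<^sup>2 * (rqfac (q^2) (int n) * rqfac (q^2) (int N - int n)))
           = qpoch (- x * q) (q^2) N * rqfac (q^2) (int N)"
proof (induction N)
  case 0
  then show ?case by simp
next
  case (Suc N)
  let ?r = "rqfac (q^2)"
  have q2: "norm (q^2) < 1"
    using assms by (simp add: norm_power power_less_one_iff)
  note rec = rqfac_rec[OF q2]
  let ?t = "\<lambda>n. x ^ n * q ^ n\<^sup>2"
  let ?S = "\<Sum>n\<le>Suc N. ?t n * (?r (int n) * ?r (int (Suc N) - int n))"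
  let ?R = "\<Sum>n\<le>N. ?t n * (?r (int n) * ?r (int N - int n))"
  have split: "(1 - (q^2) ^ Suc N) * (?r (int n) * ?r (int (Suc N) - int n)) =
      ?r (int n) * ?r (int N - int n) +
      (q^2) ^ (Suc N - n) * (?r (int n - 1) * ?r (int (Suc N) - int n))" if "n \<le> Suc N" for n
  proof -
    have 1: "?r (int N - int n) = (1 - (q^2) ^ (Suc N - n)) * ?r (int (Suc N) - int n)"
    proof -
      have 4: "int (Suc N - n) = int (Suc N) - int n" and 5: "int (Suc N) - int n - 1 = int N - int n"
        using that by auto
      have "(1 - (q^2) ^ (Suc N - n)) * ?r (int (Suc N - n)) = ?r (int (Suc N - n) - 1)"
        using rec[of "int (Suc N - n)"] unfolding power_int_of_nat .
      then show ?thesis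
        unfolding 4 5 by (rule sym)
    qed
    have 2: "?r (int n - 1) = (1 - (q^2) ^ n) * ?r (int n)"
      using rec[of "int n"] by simp
    have 3: "(q^2) ^ Suc N = (q^2) ^ (Suc N - n) * (q^2) ^ n"
      using that by (simp only: power_add[symmetric]) simp
    show ?thesis unfolding 1 2 3 by (simp add: algebra_simps)
  qed
  have "(1 - (q^2) ^ Suc N) * ?S =
      (\<Sum>n\<le>Suc N. ?t n * ((1 - (q^2) ^ Suc N) * (?r (int n) * ?r (int (Suc N) - int n))))"
    by (simp only: sum_distrib_left mult_ac)
  also have "\<dots> = (\<Sum>n\<le>Suc N. ?t n * (?r (int n) * ?r (int N - int n)) +
      ?t n * ((q^2) ^ (Suc N - n) * (?r (int n - 1) * ?r (int (Suc N) - int n))))"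
    by (intro sum.cong refl) (simp only: split atMost_iff distrib_left)
  also have "\<dots> = ?R + (\<Sum>n\<le>Suc N. ?t n * ((q^2) ^ (Suc N - n) * (?r (int n - 1) * ?r (int (Suc N) - int n))))"
    by (simp add: sum.distrib)
  also have "(\<Sum>n\<le>Suc N. ?t n * ((q^2) ^ (Suc N - n) * (?r (int n - 1) * ?r (int (Suc N) - int n)))) =
     (\<Sum>n\<le>N. ?t (Suc n) * ((q^2) ^ (N - n) * (?r (int n) * ?r (int N - int n))))"
    by (subst sum.atMost_Suc_shift) simp
  also have "\<dots> = (\<Sum>n\<le>N. x * q * (q^2) ^ N * (?t n * (?r (int n) * ?r (int N - int n))))"
  proof (intro sum.cong refl)
    fix n assume "n \<in> {..N}"
    then obtain d where d: "N = n + d" by (auto simp: le_iff_add)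
    have "(Suc n)\<^sup>2 + 2 * (N - n) = 1 + 2 * N + n\<^sup>2"
      by (simp add: d power2_eq_square)
    then have "q ^ ((Suc n)\<^sup>2 + 2 * (N - n)) = q ^ (1 + 2 * N + n\<^sup>2)"
      by (simp only:)
    then have "q ^ (Suc n)\<^sup>2 * (q^2) ^ (N - n) = q * (q^2) ^ N * q ^ n\<^sup>2"
      by (simp only: power_add power_mult power_one_right)
    then have "?t (Suc n) * (q^2) ^ (N - n) = x * q * (q^2) ^ N * ?t n"
      by (simp add: algebra_simps)
    then show "?t (Suc n) * ((q^2) ^ (N - n) * (?r (int n) * ?r (int N - int n))) =
        x * q * (q^2) ^ N * (?t n * (?r (int n) * ?r (int N - int n)))"
      by (metis mult.assoc)
  qed
  also have "\<dots> = x * q * (q^2) ^ N * ?R"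
    by (simp only: sum_distrib_left)
  also have "?R + x * q * (q^2) ^ N * ?R = (1 - (- x * q) * (q^2) ^ N) * ?R"
    by (simp add: algebra_simps)
  also have "\<dots> = qpoch (- x * q) (q^2) (Suc N) * ?r (int N)"
    unfolding Suc.IH qpoch_Suc by simp
  also have "?r (int N) = (1 - (q^2) ^ Suc N) * ?r (int (Suc N))"
    using rec[of "int (Suc N)"] by (simp only: power_int_of_nat) simp
  finally have "(1 - (q^2) ^ Suc N) * ?S =
      (1 - (q^2) ^ Suc N) * (qpoch (- x * q) (q^2) (Suc N) * ?r (int (Suc N)))"
    by (simp only: mult_ac)
  moreover have "1 - (q^2) ^ Suc N \<noteq> 0"
    using one_minus_mult_power_nonzero[OF q2 q2, of N] by simp
  ultimately show ?case
    by (rule mult_left_cancel[THEN iffD1, rotated])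
qed

text \<open>
  Both sides are the coefficient of \<open>z\<^sup>n\<close> in
  \<open>(-z;q\<^sup>2)\<^sub>\<infinity> / (z\<^sup>2;q\<^sup>4)\<^sub>\<infinity> = 1 / (z;q\<^sup>2)\<^sub>\<infinity>\<close>, expanded by Euler's two series.
  The proof works with coefficients: splitting
  \<open>1 - Q\<^sup>n = (1 - Q\<^sup>n\<^sup>-\<^sup>2\<^sup>k) + Q\<^sup>n\<^sup>-\<^sup>2\<^sup>k (1 - Q\<^sup>2\<^sup>k)\<close> with \<open>Q = q\<^sup>2\<close> shows that the sum satisfies
  the recurrence of \<open>1/(Q;Q)\<^sub>n\<close>.
\<close>

lemma rqfac_even_odd_sum:
  fixes q :: complex
  assumes "q \<noteq> 0" "norm q < 1"
  shows "(\<Sum>k\<le>n. q powi ((int n - 2 * int k)\<^sup>2 - (int n - 2 * int k)) *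
            (rqfac (q^2) (int n - 2 * int k) * rqfac (q^4) (int k))) = rqfac (q^2) (int n)"
proof (induction n)
  case 0
  then show ?case by simp
next
  case (Suc n)
  let ?r = "rqfac (q^2)" and ?s = "rqfac (q^4)"
  have q2: "norm (q^2) < 1" and q4: "norm (q^4) < 1"
    using assms by (simp_all add: norm_power power_less_one_iff)
  define t where "t m = q powi (m\<^sup>2 - m)" for m :: int
  let ?S = "\<Sum>k\<le>Suc n. t (int (Suc n) - 2 * int k) * (?r (int (Suc n) - 2 * int k) * ?s (int k))"
  have tS: "t m * (q^2) powi m = t (m + 1)" for m
  proof -
    have "t m * (q^2) powi m = q powi (m\<^sup>2 - m) * q powi (2 * m)"
      by (simp add: t_def power_int_mult)
    also have "\<dots> = q powi ((m\<^sup>2 - m) + 2 * m)"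
      by (rule power_int_add[symmetric]) (use assms in simp)
    also have "(m\<^sup>2 - m) + 2 * m = (m + 1)\<^sup>2 - (m + 1)"
      by (simp add: power2_eq_square algebra_simps)
    finally show ?thesis by (simp add: t_def)
  qed
  have split: "(1 - (q^2) ^ Suc n) * (t m * (?r m * ?s (int k))) =
     t m * (?r (m - 1) * ?s (int k)) + t (m + 1) * (?r m * ?s (int k - 1))"
    if m: "m = int (Suc n) - 2 * int k" for m k
  proof -
    have 1: "?r (m - 1) = (1 - (q^2) powi m) * ?r m"
      using rqfac_rec[OF q2] by simp
    have 2: "?s (int k - 1) = (1 - (q^2) powi (2 * int k)) * ?s (int k)"
      using rqfac_rec[OF q4, of "int k"]
      by (simp add: power_int_mult power_int_of_nat power_mult[symmetric])
    have 3: "(q^2) ^ Suc n = (q^2) powi m * (q^2) powi (2 * int k)"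
    proof -
      have "(q^2) powi m * (q^2) powi (2 * int k) = (q^2) powi (m + 2 * int k)"
        by (rule power_int_add[symmetric]) (use assms in simp)
      also have "m + 2 * int k = int (Suc n)" using m by simp
      finally show ?thesis by (simp only: power_int_of_nat)
    qed
    show ?thesis unfolding 1 2 3 tS[of m, symmetric] by (simp add: algebra_simps)
  qed
  have "(1 - (q^2) ^ Suc n) * ?S = 
      (\<Sum>k\<le>Suc n. t (int (Suc n) - 2 * int k) * (?r (int (Suc n) - 2 * int k - 1) * ?s (int k))) +
      (\<Sum>k\<le>Suc n. t (int (Suc n) - 2 * int k + 1) * (?r (int (Suc n) - 2 * int k) * ?s (int k - 1)))"
    unfolding sum_distrib_left sum.distrib[symmetric]
    by (intro sum.cong refl split)
  also have "(\<Sum>k\<le>Suc n. t (int (Suc n) - 2 * int k) * (?r (int (Suc n) - 2 * int k - 1) * ?s (int k))) =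
      (\<Sum>k\<le>n. t (int n - 2 * int k + 1) * (?r (int n - 2 * int k) * ?s (int k)))"
    by (simp add: algebra_simps)
  also have "(\<Sum>k\<le>Suc n. t (int (Suc n) - 2 * int k + 1) * (?r (int (Suc n) - 2 * int k) * ?s (int k - 1))) =
      (\<Sum>k\<le>n. t (int n - 2 * int k) * (?r (int n - 2 * int k - 1) * ?s (int k)))"
    by (subst sum.atMost_Suc_shift) (simp add: algebra_simps)
  also have "(\<Sum>k\<le>n. t (int n - 2 * int k + 1) * (?r (int n - 2 * int k) * ?s (int k))) + \<dots> =
      (\<Sum>k\<le>n. t (int n - 2 * int k) * (?r (int n - 2 * int k) * ?s (int k)))"
    unfolding sum.distrib[symmetric]
  proof (intro sum.cong refl)
    fix k
    have rm: "?r (int n - 2 * int k - 1) = (1 - (q^2) powi (int n - 2 * int k)) * ?r (int n - 2 * int k)"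
      using rqfac_rec[OF q2] by simp
    show "t (int n - 2 * int k + 1) * (?r (int n - 2 * int k) * ?s (int k)) +
         t (int n - 2 * int k) * (?r (int n - 2 * int k - 1) * ?s (int k)) =
         t (int n - 2 * int k) * (?r (int n - 2 * int k) * ?s (int k))"
      unfolding rm tS[symmetric] by (simp add: algebra_simps)
  qed
  also have "\<dots> = ?r (int n)"
    using Suc.IH by (simp add: t_def)
  also have "?r (int n) = (1 - (q^2) ^ Suc n) * ?r (int (Suc n))"
    using rqfac_rec[OF q2, of "int (Suc n)"] by (simp only: power_int_of_nat) simp
  finally have "(1 - (q^2) ^ Suc n) * ?S = (1 - (q^2) ^ Suc n) * ?r (int (Suc n))" .
  moreover have nz: "1 - (q^2) ^ Suc n \<noteq> 0"
    using one_minus_mult_power_nonzero[OF q2 q2, of n] by simp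
  ultimately have "?S = ?r (int (Suc n))"
    by (rule mult_left_cancel[THEN iffD1, rotated])
  then show ?case
    unfolding t_def .
qed

section \<open>Convergence\<close>

(* Two library constants share this infix; it is kept for absolute summability in the sense of
   Infinite_Sum, i.e. summability of the norms. *)
no_notation Infinite_Set_Sum.abs_summable_on (infix \<open>abs'_summable'_on\<close> 50)

text \<open>
  Tannery's theorem for sums over an arbitrary index set: this is dominated convergence for the
  counting measure.
\<close>

lemma tendsto_infsum_dominated:
  fixes f :: "nat \<Rightarrow> 'a \<Rightarrow> complex" and M :: "'a \<Rightarrow> real"
  assumes lim: "\<And>x. x \<in> A \<Longrightarrow> (\<lambda>n. f n x) \<longlonglongrightarrow> g x"
    and bound: "\<And>n x. x \<in> A \<Longrightarrow> norm (f n x) \<le> M x"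
    and M: "M summable_on A"
  shows "(\<lambda>n. infsum (f n) A) \<longlonglongrightarrow> infsum g A" and "g abs_summable_on A"
proof -
  have g_bound: "norm (g x) \<le> M x" if "x \<in> A" for x
    by (rule LIMSEQ_le_const2[OF tendsto_norm[OF lim[OF that]]]) (use bound[OF that] in auto)
  have f_sum: "f n abs_summable_on A" for n
    by (rule summable_on_comparison_test[OF M]) (use bound in auto)
  show g_sum: "g abs_summable_on A"
    by (rule summable_on_comparison_test[OF M]) (use g_bound in auto)
  have M_nonneg: "M x \<ge> 0" if "x \<in> A" for x
    using g_bound[OF that] norm_ge_zero order_trans by blast
  have "M abs_summable_on A"
    by (rule summable_on_cong[THEN iffD1, OF _ M]) (use M_nonneg in auto)
  then have int: "integrable (count_space A) M"
    unfolding abs_summable_equivalent Infinite_Set_Sum.abs_summable_on_def .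
  have "(\<lambda>n. integral\<^sup>L (count_space A) (f n)) \<longlonglongrightarrow> integral\<^sup>L (count_space A) g"
    by (rule integral_dominated_convergence[OF _ _ int])
       (use lim bound in \<open>auto simp: AE_count_space\<close>)
  moreover have "integral\<^sup>L (count_space A) (f n) = infsum (f n) A" for n
    using f_sum infsetsum_infsum by (metis abs_summable_equivalent infsetsum_def)
  moreover have "integral\<^sup>L (count_space A) g = infsum g A"
    using g_sum infsetsum_infsum by (metis abs_summable_equivalent infsetsum_def)
  ultimately show "(\<lambda>n. infsum (f n) A) \<longlonglongrightarrow> infsum g A"
    by simp
qed

lemma abs_summable_on_mult_Times:
  fixes f :: "'a \<Rightarrow> complex" and g :: "'b \<Rightarrow> complex"
  assumes "f abs_summable_on A" "g abs_summable_on B"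
  shows "(\<lambda>(x, y). f x * g y) abs_summable_on A \<times> B"
proof (rule Infinite_Sum.abs_summable_on_Sigma_iff[THEN iffD2], intro conjI ballI)
  fix x
  show "(\<lambda>y. case (x, y) of (x, y) \<Rightarrow> f x * g y) abs_summable_on B"
    using assms(2) by (simp add: norm_mult summable_on_cmult_right)
next
  have "(\<lambda>x. norm (f x) * infsum (\<lambda>y. norm (g y)) B) summable_on A"
    using assms(1) by (rule summable_on_cmult_left)
  moreover have "infsum (\<lambda>y. norm (g y)) B \<ge> 0"
    by (rule infsum_nonneg) simp
  ultimately show "(\<lambda>x. \<Sum>\<^sub>\<infinity>y\<in>B. norm (case (x, y) of (x, y) \<Rightarrow> f x * g y)) abs_summable_on A"
    by (simp add: norm_mult infsum_cmult_right')
qed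

lemma abs_summable_on_mult_bounded:
  fixes f g :: "'a \<Rightarrow> complex"
  assumes "f abs_summable_on A" "\<And>x. x \<in> A \<Longrightarrow> norm (g x) \<le> C"
  shows "(\<lambda>x. f x * g x) abs_summable_on A"
proof (rule summable_on_comparison_test)
  show "(\<lambda>x. norm (f x) * C) summable_on A"
    using assms(1) by (rule summable_on_cmult_left)
qed (auto simp: norm_mult intro!: mult_left_mono assms(2))

lemma summable_on_power_nat_abs:
  fixes c :: real
  assumes "0 \<le> c" "c < 1"
  shows "(\<lambda>r::int. c ^ nat \<bar>r\<bar>) summable_on UNIV"
proof -
  have geo: "(\<lambda>n::nat. c ^ n) summable_on UNIV"
    using assms by (subst summable_on_UNIV_nonneg_real_iff) auto
  have "(\<lambda>r::int. c ^ nat \<bar>r\<bar>) summable_on range int"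
    by (subst summable_on_reindex) (auto simp: o_def geo)
  moreover have "(\<lambda>r::int. c ^ nat \<bar>r\<bar>) summable_on range (\<lambda>n. - int n)"
    by (subst summable_on_reindex) (auto simp: o_def geo inj_def)
  ultimately have "(\<lambda>r::int. c ^ nat \<bar>r\<bar>) summable_on (range int \<union> range (\<lambda>n. - int n))"
    by (rule summable_on_union)
  moreover have "range int \<union> range (\<lambda>n. - int n) = UNIV"
    by (auto intro: int_cases2)
  ultimately show ?thesis by simp
qed

text \<open>
  The quadratic exponent wins: with \<open>c = norm q\<close> choose \<open>m\<close> so that \<open>norm y\<close> and its inverse are below
  \<open>c\<^sup>-\<^sup>m\<close>. Then \<open>m k + k \<le> k\<^sup>2 + (m + 1)\<^sup>2\<close> for \<open>k = \<bar>r\<bar>\<close> bounds the terms by a multiple of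
  the geometric sequence \<open>c\<^sup>k\<close>.
\<close>

lemma abs_summable_theta:
  fixes q y :: complex
  assumes "q \<noteq> 0" "norm q < 1" "y \<noteq> 0"
  shows "(\<lambda>r::int. y powi r * q powi r\<^sup>2) abs_summable_on UNIV"
proof -
  define c where "c = norm q"
  have c: "0 < c" "c < 1" using assms by (auto simp: c_def)
  obtain m where m: "c ^ m < min (norm y) (1 / norm y)"
    using real_arch_pow_inv[of "min (norm y) (1 / norm y)" c] c assms(3) by auto
  have ym: "norm y < inverse c ^ m" "inverse (norm y) < inverse c ^ m"
    using m c assms(3) by (auto simp: field_simps)
  show ?thesis
  proof (rule summable_on_comparison_test)
    show "(\<lambda>r::int. c ^ nat \<bar>r\<bar> * inverse c ^ ((m + 1)\<^sup>2)) summable_on UNIV"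
      using c by (intro summable_on_cmult_left summable_on_power_nat_abs) auto
  next
    fix r :: int
    define k where "k = nat \<bar>r\<bar>"
    have 1: "norm (y powi r) \<le> (inverse c ^ m) ^ k"
    proof (cases "r \<ge> 0")
      case True
      then show ?thesis using ym
        by (auto simp: k_def power_int_def norm_power intro!: power_mono)
    next
      case False
      then show ?thesis using ym
        by (auto simp: k_def power_int_def norm_power norm_inverse intro!: power_mono)
    qed
    have "r\<^sup>2 = int (k\<^sup>2)" by (simp add: k_def)
    then have 2: "norm (q powi r\<^sup>2) = c ^ k\<^sup>2"
      by (simp only: power_int_of_nat norm_power c_def)
    have "m * k + k \<le> k\<^sup>2 + (m + 1)\<^sup>2"
    proof (cases "k \<ge> m + 1")
      case True
      then have "(m + 1) * k \<le> k * k" by (intro mult_right_mono) auto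
      then show ?thesis by (simp add: power2_eq_square)
    next
      case False
      then have "(m + 1) * k \<le> (m + 1) * (m + 1)" by (intro mult_left_mono) auto
      then show ?thesis by (simp add: power2_eq_square)
    qed
    then have "c ^ (k\<^sup>2 + (m + 1)\<^sup>2) \<le> c ^ (m * k + k)"
      using c by (intro power_decreasing) auto
    then have "(inverse c ^ m) ^ k * c ^ k\<^sup>2 \<le> c ^ k * inverse c ^ ((m + 1)\<^sup>2)"
      using c by (simp add: power_add power_mult power_inverse field_simps power_commutes
          flip: power_mult del: One_nat_def)
    moreover have "norm (y powi r * q powi r\<^sup>2) \<le> (inverse c ^ m) ^ k * c ^ k\<^sup>2"
      unfolding norm_mult 2 using 1 c by (intro mult_right_mono) auto
    ultimately show "norm (y powi r * q powi r\<^sup>2) \<le> c ^ nat \<bar>r\<bar> * inverse c ^ ((m + 1)\<^sup>2)"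
      by (simp add: k_def)
  qed auto
qed

lemma abs_summable_quadratic:
  fixes q :: complex
  assumes "q \<noteq> 0" "norm q < 1" "a > 0"
  shows "(\<lambda>r::int. q powi (int a * r\<^sup>2 + b * r)) abs_summable_on UNIV"
proof -
  have "(\<lambda>r::int. (q powi b) powi r * (q ^ a) powi r\<^sup>2) abs_summable_on UNIV"
    using assms by (intro abs_summable_theta) (auto simp: norm_power power_less_one_iff)
  also have "(\<lambda>r::int. (q powi b) powi r * (q ^ a) powi r\<^sup>2) = (\<lambda>r::int. q powi (int a * r\<^sup>2 + b * r))"
    using assms(1) by (simp add: power_int_add power_int_mult) (simp add: mult.commute)
  finally show ?thesis .
qed

lemma abs_summable_quadratic_nat:
  fixes q :: complex
  assumes "q \<noteq> 0" "norm q < 1" "a > 0"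
  shows "(\<lambda>n::nat. q powi (int a * (int n)\<^sup>2 + b * int n)) abs_summable_on UNIV"
proof -
  have "(\<lambda>r::int. norm (q powi (int a * r\<^sup>2 + b * r))) summable_on range int"
    using abs_summable_quadratic[OF assms] by (rule summable_on_subset) auto
  then show ?thesis
    by (subst (asm) summable_on_reindex) (auto simp: o_def)
qed

section \<open>The Jacobi triple product\<close>

text \<open>
  The kernel \<open>1 / ((q;q)\<^sub>n\<^sub>-\<^sub>r (q;q)\<^sub>n\<^sub>+\<^sub>r)\<close> of Bailey pairs relative to \<open>a = 1\<close>. Up to the factor
  \<open>(q;q)\<^sub>2\<^sub>n\<close> it is also the q-binomial coefficient that occurs in the finite triple product.
\<close>

definition bkernel :: "complex \<Rightarrow> nat \<Rightarrow> int \<Rightarrow> complex" where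
  "bkernel q n r = rqfac q (int n - r) * rqfac q (int n + r)"

lemma bkernel_eq_0: "r \<notin> {- int n..int n} \<Longrightarrow> bkernel q n r = 0"
  by (auto simp: bkernel_def)

lemma bkernel_minus: "bkernel q n (- r) = bkernel q n r"
  by (simp add: bkernel_def mult.commute)

lemma bkernel_bounded:
  assumes "norm q < 1"
  obtains C where "C > 0" "\<And>n r. norm (bkernel q n r) \<le> C"
proof -
  obtain C where C: "C > 0" "\<And>m. norm (rqfac q m) \<le> C"
    using rqfac_bounded[OF assms] by blast
  have "norm (bkernel q n r) \<le> C * C" for n r
    unfolding bkernel_def norm_mult using C by (intro mult_mono) (auto intro: less_imp_le)
  with C that[of "C * C"] show ?thesis by simp
qed

lemma bkernel_LIMSEQ:
  assumes "norm q < 1"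
  shows "(\<lambda>n. bkernel q n r) \<longlonglongrightarrow> 1 / (qpoch_inf q q)\<^sup>2"
proof -
  have lim: "(\<lambda>n. rqfac q (int n + r)) \<longlonglongrightarrow> 1 / qpoch_inf q q" for r
  proof (rule Lim_transform_eventually)
    have "filterlim (\<lambda>n. nat (int n + r)) sequentially sequentially"
      unfolding filterlim_at_top eventually_sequentially by (metis add_le_imp_le_right le_diff_conv nat_int nat_mono nle_le of_nat_le_iff diff_le_eq le_nat_iff nat_le_iff)
    from filterlim_compose[OF rqfac_LIMSEQ[OF assms] this]
    show "(\<lambda>n. rqfac q (int (nat (int n + r)))) \<longlonglongrightarrow> 1 / qpoch_inf q q" .
    show "eventually (\<lambda>n. rqfac q (int (nat (int n + r))) = rqfac q (int n + r)) sequentially"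
      using eventually_ge_at_top[of "nat \<bar>r\<bar>"] by eventually_elim auto
  qed
  have "(\<lambda>n. rqfac q (int n + (- r)) * rqfac q (int n + r)) \<longlonglongrightarrow> 1 / qpoch_inf q q * (1 / qpoch_inf q q)"
    by (intro tendsto_mult lim)
  then show ?thesis
    by (simp add: bkernel_def power2_eq_square)
qed

text \<open>
  The q-binomial theorem with \<open>2 n\<close> factors, re-centred at the middle term. For \<open>x = y q\<^sup>-\<^sup>2\<^sup>n\<close> the
  factors \<open>1 + x q\<^sup>2\<^sup>m\<^sup>+\<^sup>1\<close> with \<open>m \<ge> n\<close> give the product in \<open>y\<close>; those with \<open>m < n\<close> give the product in
  \<open>1/y\<close> after the monomial \<open>y\<^sup>n q powi (- n\<^sup>2)\<close> has been taken out.
\<close>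

lemma finite_triple_product:
  fixes q y :: complex
  assumes "q \<noteq> 0" "norm q < 1" "y \<noteq> 0"
  shows "(\<Sum>r\<in>{- int n..int n}. y powi r * q powi r\<^sup>2 * bkernel (q^2) n r)
    = qpoch (- y * q) (q^2) n * qpoch (- q / y) (q^2) n * rqfac (q^2) (int (2 * n))"
proof -
  have prod: "qpoch (- (x * q powi (- 2 * int n)) * q) (q^2) (2 * n)
      = x ^ n * q powi (- (int n)\<^sup>2) * (qpoch (- x * q) (q^2) n * qpoch (- q / x) (q^2) n)"
    if "x \<noteq> 0" for x
  proof (induction n)
    case 0
    then show ?case by simp
  next
    case (Suc n)
    have e1: "- (x * q powi (- 2 * int (Suc n))) * q * q\<^sup>2 = - (x * q powi (- 2 * int n)) * q"
      using assms(1) by (simp add: power_int_diff power_int_minus power2_eq_square field_simps)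
    have e2: "- (x * q powi (- 2 * int n)) * q * (q\<^sup>2) ^ (2 * n) = - x * q * (q^2) ^ n"
      using assms(1) by (simp add: power_int_minus power_mult[symmetric] field_simps power_int_mult flip: power_add)
    have e3: "1 - - (x * q powi (- 2 * int (Suc n))) * q =
       x * q powi (- (2 * int n + 1)) * (1 - - q / x * (q^2) ^ n)"
      using assms(1) that
      by (simp add: power_int_minus power_int_add power_int_diff power_mult[symmetric] field_simps power_int_mult power2_eq_square)
    have e4: "q powi (- (int (Suc n))\<^sup>2) = q powi (- (int n)\<^sup>2) * q powi (- (2 * int n + 1))"
    proof -
      have "q powi (- (int n)\<^sup>2) * q powi (- (2 * int n + 1)) = q powi (- (int n)\<^sup>2 + - (2 * int n + 1))"
        by (rule power_int_add[symmetric]) (use assms in simp)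
      also have "- (int n)\<^sup>2 + - (2 * int n + 1) = - (int (Suc n))\<^sup>2"
        by (simp add: power2_eq_square algebra_simps)
      finally show ?thesis by simp
    qed
    have "2 * Suc n = Suc (Suc (2 * n))" by simp
    then have "qpoch (- (x * q powi (- 2 * int (Suc n))) * q) (q^2) (2 * Suc n) =
      (1 - - (x * q powi (- 2 * int (Suc n))) * q) *
        (qpoch (- (x * q powi (- 2 * int n)) * q) (q^2) (2 * n) *
        (1 - - x * q * (q^2) ^ n))"
      by (simp only: qpoch_Suc_shift[of _ _ "Suc (2 * n)"] e1 qpoch_Suc[of _ _ "2 * n"] e2)
    also have "\<dots> = x ^ Suc n * q powi (- (int (Suc n))\<^sup>2) *
       (qpoch (- x * q) (q^2) (Suc n) * qpoch (- q / x) (q^2) (Suc n))"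
      unfolding Suc.IH e3 e4 qpoch_Suc power_Suc by (simp only: mult_ac)
    finally show ?case .
  qed
  let ?z = "y * q powi (- 2 * int n)"
  have "(\<Sum>k\<le>2 * n. ?z ^ k * q ^ k\<^sup>2 * (rqfac (q^2) (int k) * rqfac (q^2) (int (2 * n) - int k)))
     = (\<Sum>r\<in>{- int n..int n}. y ^ n * q powi (- (int n)\<^sup>2) * (y powi r * q powi r\<^sup>2 * bkernel (q^2) n r))"
  proof (rule sum.reindex_bij_witness[where i = "\<lambda>r. nat (int n + r)" and j = "\<lambda>k. int k - int n"])
    fix k assume k: "k \<in> {..2 * n}"
    have "?z ^ k * q ^ k\<^sup>2 = y powi (int k) * (q powi (- 2 * int n * int k) * q powi ((int k)\<^sup>2))"
      by (simp only: power_mult_distrib power_int_mult power_int_of_nat of_nat_power[symmetric] mult.assoc)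
    also have "q powi (- 2 * int n * int k) * q powi ((int k)\<^sup>2) = q powi (- 2 * int n * int k + (int k)\<^sup>2)"
      by (rule power_int_add[symmetric]) (use assms in simp)
    also have "- 2 * int n * int k + (int k)\<^sup>2 = - (int n)\<^sup>2 + (int k - int n)\<^sup>2"
      by (simp add: power2_eq_square algebra_simps)
    also have "q powi \<dots> = q powi (- (int n)\<^sup>2) * q powi ((int k - int n)\<^sup>2)"
      by (rule power_int_add) (use assms in simp)
    also have "y powi (int k) = y ^ n * y powi (int k - int n)"
      using assms(3) by (simp add: power_int_diff)
    finally show "y ^ n * q powi (- (int n)\<^sup>2) * (y powi (int k - int n) * q powi (int k - int n)\<^sup>2 * bkernel (q^2) n (int k - int n))
       = ?z ^ k * q ^ k\<^sup>2 * (rqfac (q^2) (int k) * rqfac (q^2) (int (2 * n) - int k))"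
      by (simp add: bkernel_def mult_ac)
  qed auto
  also have "\<dots> = y ^ n * q powi (- (int n)\<^sup>2) * (\<Sum>r\<in>{- int n..int n}. y powi r * q powi r\<^sup>2 * bkernel (q^2) n r)"
    by (simp only: sum_distrib_left)
  finally have "y ^ n * q powi (- (int n)\<^sup>2) * (\<Sum>r\<in>{- int n..int n}. y powi r * q powi r\<^sup>2 * bkernel (q^2) n r) =
    y ^ n * q powi (- (int n)\<^sup>2) * (qpoch (- y * q) (q^2) n * qpoch (- q / y) (q^2) n * rqfac (q^2) (int (2 * n)))"
    unfolding qbinomial_sum[OF assms(2)] prod[OF assms(3)] by (simp only: mult_ac)
  then show ?thesis
    using assms by simp
qed

text \<open>
  The limit of the finite triple product. The kernel is uniformly bounded and tends to
  \<open>1/(q\<^sup>2;q\<^sup>2)\<^sub>\<infinity>\<^sup>2\<close> for each fixed \<open>r\<close>, so the limit may be taken under the sum.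
\<close>

theorem jacobi_triple_product:
  fixes q y :: complex
  assumes "q \<noteq> 0" "norm q < 1" "y \<noteq> 0"
  shows "((\<lambda>r::int. y powi r * q powi r\<^sup>2) has_sum
     qpoch_inf (- y * q) (q^2) * qpoch_inf (- q / y) (q^2) * qpoch_inf (q^2) (q^2)) UNIV"
proof -
  have q2: "norm (q^2) < 1" using assms by (simp add: norm_power power_less_one_iff)
  let ?\<theta> = "\<lambda>r::int. y powi r * q powi r\<^sup>2"
  let ?P = "qpoch_inf (q^2) (q^2)"
  have P: "?P \<noteq> 0" using q2 by (intro qpoch_inf_nonzero)
  note theta = abs_summable_theta[OF assms]
  obtain C where C: "C > 0" "\<And>n r. norm (bkernel (q^2) n r) \<le> C"
    using bkernel_bounded[OF q2] by blast
  have "(\<lambda>n. \<Sum>\<^sub>\<infinity>r. ?\<theta> r * bkernel (q^2) n r) \<longlonglongrightarrow> (\<Sum>\<^sub>\<infinity>r. ?\<theta> r * (1 / ?P\<^sup>2))"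
  proof (rule tendsto_infsum_dominated)
    show "(\<lambda>r. norm (?\<theta> r) * C) summable_on UNIV"
      using theta by (rule summable_on_cmult_left)
    show "norm (?\<theta> r * bkernel (q^2) n r) \<le> norm (?\<theta> r) * C" for n r
      unfolding norm_mult[of "?\<theta> r"] using C(2) by (intro mult_left_mono) auto
  qed (intro tendsto_intros bkernel_LIMSEQ q2)
  moreover have "(\<Sum>\<^sub>\<infinity>r. ?\<theta> r * bkernel (q^2) n r) =
      qpoch (- y * q) (q^2) n * qpoch (- q / y) (q^2) n * rqfac (q^2) (int (2 * n))" for n
  proof -
    have "(\<Sum>\<^sub>\<infinity>r. ?\<theta> r * bkernel (q^2) n r) = (\<Sum>\<^sub>\<infinity>r\<in>{- int n..int n}. ?\<theta> r * bkernel (q^2) n r)"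
      by (rule infsum_cong_neutral) (auto simp: bkernel_eq_0)
    then show ?thesis
      using finite_triple_product[OF assms] by simp
  qed
  moreover have "(\<lambda>n. qpoch (- y * q) (q^2) n * qpoch (- q / y) (q^2) n * rqfac (q^2) (int (2 * n))) \<longlonglongrightarrow>
     qpoch_inf (- y * q) (q^2) * qpoch_inf (- q / y) (q^2) * (1 / ?P)"
    using LIMSEQ_subseq_LIMSEQ[OF rqfac_LIMSEQ[OF q2], of "\<lambda>n. 2 * n"]
    by (intro tendsto_mult qpoch_LIMSEQ q2) (auto simp: strict_mono_def o_def)
  ultimately have "(\<Sum>\<^sub>\<infinity>r. ?\<theta> r * (1 / ?P\<^sup>2)) =
     qpoch_inf (- y * q) (q^2) * qpoch_inf (- q / y) (q^2) * (1 / ?P)"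
    by (simp only:) (rule LIMSEQ_unique)
  then have "infsum ?\<theta> UNIV = qpoch_inf (- y * q) (q^2) * qpoch_inf (- q / y) (q^2) * ?P"
    using P by (simp only: infsum_cmult_left') (simp add: field_simps power2_eq_square)
  moreover have "?\<theta> summable_on UNIV"
    using theta by (rule abs_summable_summable)
  ultimately show ?thesis
    by (metis has_sum_infsum)
qed

section \<open>Euler's and Lebesgue's identities\<close>

lemma abs_summable_theta_nat:
  fixes q x :: complex
  assumes "q \<noteq> 0" "norm q < 1" "x \<noteq> 0"
  shows "(\<lambda>n::nat. x ^ n * q ^ n\<^sup>2) abs_summable_on UNIV"
proof -
  have "(\<lambda>r::int. norm (x powi r * q powi r\<^sup>2)) summable_on range int"
    using abs_summable_theta[OF assms] by (rule summable_on_subset) auto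
  then have "(\<lambda>n::nat. norm (x powi int n * q powi (int n)\<^sup>2)) summable_on UNIV"
    by (subst (asm) summable_on_reindex) (auto simp: o_def)
  then show ?thesis
    by (simp only: power_int_of_nat of_nat_power[symmetric])
qed

text \<open>
  The limit \<open>N \<rightarrow> \<infinity>\<close> of the finite q-binomial theorem, taken under the sum.
\<close>

theorem euler_q_exponential:
  fixes q x :: complex
  assumes "q \<noteq> 0" "norm q < 1" "x \<noteq> 0"
  shows "((\<lambda>n. x ^ n * q ^ n\<^sup>2 * rqfac (q^2) (int n)) has_sum qpoch_inf (- x * q) (q^2)) UNIV"
proof -
  have q2: "norm (q^2) < 1" using assms by (simp add: norm_power power_less_one_iff)
  let ?t = "\<lambda>n. x ^ n * q ^ n\<^sup>2"
  let ?r = "\<lambda>m. rqfac (q^2) m"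
  let ?P = "qpoch_inf (q^2) (q^2)"
  have P: "?P \<noteq> 0" using q2 by (intro qpoch_inf_nonzero)
  note t = abs_summable_theta_nat[OF assms]
  obtain C where C: "C > 0" "\<And>m. norm (?r m) \<le> C"
    using rqfac_bounded[OF q2] by blast
  have "(\<lambda>N. \<Sum>\<^sub>\<infinity>n. ?t n * (?r (int n) * ?r (int N - int n))) \<longlonglongrightarrow>
      (\<Sum>\<^sub>\<infinity>n. ?t n * (?r (int n) * (1 / ?P)))"
  proof (rule tendsto_infsum_dominated)
    show "(\<lambda>n. norm (?t n) * (C * C)) summable_on UNIV"
      using t by (rule summable_on_cmult_left)
    show "norm (?t n * (?r (int n) * ?r (int N - int n))) \<le> norm (?t n) * (C * C)" for n N
      unfolding norm_mult[of "?t n"] norm_mult[of "?r _"]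
      using C by (intro mult_left_mono mult_mono) (auto intro: less_imp_le)
    show "(\<lambda>N. ?t n * (?r (int n) * ?r (int N - int n))) \<longlonglongrightarrow> ?t n * (?r (int n) * (1 / ?P))" for n
    proof (intro tendsto_intros)
      have "(\<lambda>N. ?r (int (N + n) - int n)) \<longlonglongrightarrow> 1 / ?P"
        using rqfac_LIMSEQ[OF q2] by simp
      then show "(\<lambda>N. ?r (int N - int n)) \<longlonglongrightarrow> 1 / ?P"
        by (rule LIMSEQ_offset)
    qed
  qed
  moreover have "(\<Sum>\<^sub>\<infinity>n. ?t n * (?r (int n) * ?r (int N - int n))) =
      qpoch (- x * q) (q^2) N * ?r (int N)" for N
  proof -
    have "(\<Sum>\<^sub>\<infinity>n. ?t n * (?r (int n) * ?r (int N - int n))) =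
        (\<Sum>\<^sub>\<infinity>n\<in>{..N}. ?t n * (?r (int n) * ?r (int N - int n)))"
      by (rule infsum_cong_neutral) auto
    then show ?thesis
      using qbinomial_sum[OF assms(2)] by simp
  qed
  moreover have "(\<lambda>N. qpoch (- x * q) (q^2) N * ?r (int N)) \<longlonglongrightarrow> qpoch_inf (- x * q) (q^2) * (1 / ?P)"
    by (intro tendsto_mult qpoch_LIMSEQ rqfac_LIMSEQ q2)
  ultimately have "(\<Sum>\<^sub>\<infinity>n. ?t n * (?r (int n) * (1 / ?P))) = qpoch_inf (- x * q) (q^2) * (1 / ?P)"
    by (simp only:) (rule LIMSEQ_unique)
  then have "(\<Sum>\<^sub>\<infinity>n. ?t n * ?r (int n)) = qpoch_inf (- x * q) (q^2)"
    using P by (simp only: mult.assoc[symmetric] infsum_cmult_left') simp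
  moreover have "(\<lambda>n. ?t n * ?r (int n)) abs_summable_on UNIV"
    by (rule abs_summable_on_mult_bounded[where C = C, OF t]) (use C(2) in auto)
  ultimately show ?thesis
    using has_sum_infsum[OF abs_summable_summable] by fastforce
qed

text \<open>
  Uniformity in both \<open>a\<close> and \<open>n\<close> is what dominated convergence needs when \<open>a\<close> tends to \<open>0\<close>. It holds
  because replacing \<open>a\<close> by \<open>-B\<close> and \<open>q\<close> by \<open>norm q\<close> enlarges every factor.
\<close>

lemma qpoch_bounded_scaled:
  assumes "norm q < 1"
  obtains C where "C > 0" "\<And>(a :: complex) n. norm a \<le> B \<Longrightarrow> norm (qpoch a q n) \<le> C"
proof -
  have "norm (complex_of_real (norm q)) < 1" using assms by simp
  then obtain C where C: "C > 0" "\<And>n. norm (qpoch (- of_real B) (of_real (norm q)) n) \<le> C"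
    using qpoch_bounded by blast
  show thesis
  proof (rule that[OF C(1)])
    fix a :: complex and n assume a: "norm a \<le> B"
    then have B: "B \<ge> 0" using norm_ge_zero order_trans by blast
    have "norm (qpoch a q n) \<le> (\<Prod>m<n. 1 + B * norm q ^ m)"
      unfolding qpoch_def prod_norm[symmetric]
    proof (intro prod_mono conjI norm_ge_zero)
      fix m
      have "norm (1 - a * q ^ m) \<le> norm (1::complex) + norm (a * q ^ m)" by (rule norm_triangle_ineq4)
      also have "\<dots> \<le> 1 + B * norm q ^ m"
        using a by (auto simp: norm_mult norm_power intro: mult_right_mono)
      finally show "norm (1 - a * q ^ m) \<le> 1 + B * norm q ^ m" .
    qed
    also have "\<dots> = norm (of_real (\<Prod>m<n. 1 + B * norm q ^ m) :: complex)"
      using B by (subst norm_of_real) (auto intro!: abs_of_nonneg[symmetric] prod_nonneg)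
    also have "of_real (\<Prod>m<n. 1 + B * norm q ^ m) = qpoch (- of_real B) (of_real (norm q)) n"
      by (simp add: qpoch_def)
    finally show "norm (qpoch a q n) \<le> C" using C(2) order_trans by blast
  qed
qed

text \<open>
  The general term \<open>(-aQ;Q)\<^sub>n Q powi (n (n + 1) / 2) / (Q;Q)\<^sub>n\<close> of Lebesgue's series with \<open>Q = q\<^sup>2\<close>.
\<close>

definition lebesgue_term :: "complex \<Rightarrow> complex \<Rightarrow> nat \<Rightarrow> complex" where
  "lebesgue_term q a n = q ^ (n\<^sup>2 + n) * (qpoch (- a * q^2) (q^2) n * rqfac (q^2) (int n))"

lemma lebesgue_term_bounded:
  fixes q :: complex
  assumes "q \<noteq> 0" "norm q < 1"
  obtains M where "M summable_on UNIV" "\<And>(a :: complex) n. norm a \<le> B \<Longrightarrow> norm (lebesgue_term q a n) \<le> M n"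
proof -
  have q2: "norm (q^2) < 1" using assms by (simp add: norm_power power_less_one_iff)
  obtain C where C: "C > 0" "\<And>m. norm (rqfac (q^2) m) \<le> C"
    using rqfac_bounded[OF q2] by blast
  obtain D where D: "D > 0" "\<And>(a :: complex) n. norm a \<le> B * norm (q^2) \<Longrightarrow> norm (qpoch a (q^2) n) \<le> D"
    using qpoch_bounded_scaled[OF q2] by blast
  show thesis
  proof (rule that)
    show "(\<lambda>n. norm (q ^ n * q ^ n\<^sup>2) * (D * C)) summable_on UNIV"
      using abs_summable_theta_nat[OF assms assms(1)] by (rule summable_on_cmult_left)
    fix a :: complex and n assume a: "norm a \<le> B"
    have "norm (qpoch (- a * q^2) (q^2) n) \<le> D"
      by (rule D(2)) (use a in \<open>auto simp: norm_mult intro: mult_right_mono\<close>)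
    moreover have "norm (q ^ n * q ^ n\<^sup>2) = norm (q ^ (n\<^sup>2 + n))"
      by (simp add: power_add mult.commute)
    ultimately show "norm (lebesgue_term q a n) \<le> norm (q ^ n * q ^ n\<^sup>2) * (D * C)"
      unfolding lebesgue_term_def norm_mult[of "q ^ (n\<^sup>2 + n)"] norm_mult[of "qpoch _ _ _"]
      using C D(1) by (auto intro!: mult_left_mono mult_mono less_imp_le[OF D(1)])
  qed
qed

text \<open>
  Lebesgue's series \<open>L\<close> satisfies \<open>L(a) = (1 + a Q\<^sup>2) L(a Q\<^sup>2)\<close>, and \<open>U\<close> is the telescoping certificate
  for this. For \<open>1 + a Q \<noteq> 0\<close> it is \<open>U n = a Q (1 - Q\<^sup>n) / (1 + a Q)\<close> times the \<open>n\<close>-th term; the factor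
  \<open>1 + a Q\<close> has been cancelled so that no value of \<open>a\<close> is excluded.
\<close>

lemma lebesgue_term_telescope:
  fixes q a :: complex
  assumes "q \<noteq> 0" "norm q < 1"
  defines "U \<equiv> \<lambda>n. case n of 0 \<Rightarrow> 0
      | Suc m \<Rightarrow> a * q^2 * (q ^ ((Suc m)\<^sup>2 + Suc m) * (qpoch (- a * q^4) (q^2) m * rqfac (q^2) (int m)))"
  shows "lebesgue_term q a n - (1 + a * q^4) * lebesgue_term q (a * q^4) n = U n - U (Suc n)"
proof (cases n)
  case 0
  then show ?thesis
    by (simp add: lebesgue_term_def U_def power_numeral_reduce algebra_simps)
next
  case (Suc m)
  have q2: "norm (q^2) < 1" using assms by (simp add: norm_power power_less_one_iff)
  define E R F x where "E = q ^ ((Suc m)\<^sup>2 + Suc m)" and "R = rqfac (q^2) (int (Suc m))"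
    and "F = qpoch (- a * q^4) (q^2) m" and "x = (q^2) ^ m"
  have 1: "qpoch (- a * q^2) (q^2) (Suc m) = (1 + a * q^2) * F"
    by (simp add: qpoch_Suc_shift F_def mult.assoc flip: power_add)
  have F': "qpoch (- a * q^4) (q^2) (Suc m) = F * (1 + a * q^4 * x)"
    by (simp add: qpoch_Suc F_def x_def)
  have 2: "(1 + a * q^4) * qpoch (- (a * q^4) * q^2) (q^2) (Suc m) =
       F * (1 + a * q^4 * x) * (1 + a * q^4 * (q^2 * x))"
  proof -
    have "(1 + a * q^4) * qpoch (- (a * q^4) * q^2) (q^2) (Suc m) = qpoch (- a * q^4) (q^2) (Suc (Suc m))"
      by (subst (2) qpoch_Suc_shift) simp
    also have "\<dots> = F * (1 + a * q^4 * x) * (1 + a * q^4 * (q^2 * x))"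
      unfolding qpoch_Suc[of _ _ "Suc m"] F' by (simp add: x_def)
    finally show ?thesis .
  qed
  have 3: "rqfac (q^2) (int m) = (1 - q^2 * x) * R"
    using rqfac_rec[OF q2, of "int (Suc m)"] unfolding power_int_of_nat by (simp add: R_def x_def)
  have 4: "q ^ ((Suc (Suc m))\<^sup>2 + Suc (Suc m)) = E * (q^4 * x)"
  proof -
    have "(Suc (Suc m))\<^sup>2 + Suc (Suc m) = ((Suc m)\<^sup>2 + Suc m) + (4 + 2 * m)"
      by (simp add: power2_eq_square)
    then show ?thesis
      by (simp only: E_def x_def power_add power_mult)
  qed
  have "lebesgue_term q a n - (1 + a * q^4) * lebesgue_term q (a * q^4) n =
      E * R * (qpoch (- a * q^2) (q^2) (Suc m) - (1 + a * q^4) * qpoch (- (a * q^4) * q^2) (q^2) (Suc m))"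
    by (simp add: lebesgue_term_def Suc E_def R_def algebra_simps)
  also have "\<dots> = E * R * F * ((1 + a * q^2) - (1 + a * q^4 * x) * (1 + a * q^4 * (q^2 * x)))"
    unfolding 1 2 by (simp add: algebra_simps)
  also have "(1 + a * q^2) - (1 + a * q^4 * x) * (1 + a * q^4 * (q^2 * x)) =
      a * q^2 * (1 - q^2 * x) - a * q^2 * (q^4 * x) * (1 + a * q^4 * x)"
  proof -
    have "q^4 = q^2 * q^2" by (simp flip: power_add)
    then show ?thesis by (simp only:) (simp add: ring_distribs mult_ac)
  qed
  also have "E * R * F * (a * q^2 * (1 - q^2 * x) - a * q^2 * (q^4 * x) * (1 + a * q^4 * x)) = U n - U (Suc n)"
    unfolding U_def Suc nat.case 3 4 F' unfolding E_def[symmetric] F_def[symmetric] R_def[symmetric]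
    by (simp add: algebra_simps)
  finally show ?thesis .
qed

text \<open>
  Iterating \<open>L(a) = (1 + a Q\<^sup>2) L(a Q\<^sup>2)\<close> produces the product in \<open>a\<close> and moves the argument to \<open>0\<close>, where
  the series is an instance of Euler's.
\<close>

theorem lebesgue_identity:
  fixes q a :: complex
  assumes "q \<noteq> 0" "norm q < 1"
  shows "(lebesgue_term q a has_sum qpoch_inf (- (q^2)) (q^2) * qpoch_inf (- a * q^4) (q^4)) UNIV"
proof -
  have q2: "norm (q^2) < 1" and q4: "norm (q^4) < 1"
    using assms by (simp_all add: norm_power power_less_one_iff)
  define L where "L a = infsum (lebesgue_term q a) UNIV" for a
  have abs: "lebesgue_term q a abs_summable_on UNIV" for a
  proof -
    obtain M where M: "M summable_on UNIV" "\<And>b n. norm b \<le> norm a \<Longrightarrow> norm (lebesgue_term q b n) \<le> M n"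
      using lebesgue_term_bounded[OF assms] by blast
    show ?thesis
      by (rule summable_on_comparison_test[OF M(1)]) (use M(2) in auto)
  qed
  have summ: "(lebesgue_term q a has_sum L a) UNIV" for a
    unfolding L_def by (rule has_sum_infsum[OF abs_summable_summable[OF abs]])
  have step: "L a = (1 + a * q^4) * L (a * q^4)" for a
  proof -
    let ?U = "\<lambda>n. case n of 0 \<Rightarrow> 0
      | Suc m \<Rightarrow> a * q^2 * (q ^ ((Suc m)\<^sup>2 + Suc m) * (qpoch (- a * q^4) (q^2) m * rqfac (q^2) (int m)))"
    have "(\<lambda>m. ?U (Suc m)) \<longlonglongrightarrow> a * q^2 * (0 * (qpoch_inf (- a * q^4) (q^2) * (1 / qpoch_inf (q^2) (q^2))))"
      unfolding nat.case
    proof (intro tendsto_mult tendsto_const qpoch_LIMSEQ rqfac_LIMSEQ q2)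
      have "strict_mono (\<lambda>m. (Suc m)\<^sup>2 + Suc m)"
        by (auto simp: strict_mono_def power2_eq_square intro!: add_less_mono mult_strict_mono)
      from LIMSEQ_subseq_LIMSEQ[OF LIMSEQ_power_zero[OF assms(2)] this]
      show "(\<lambda>m. q ^ ((Suc m)\<^sup>2 + Suc m)) \<longlonglongrightarrow> 0" by (simp add: o_def)
    qed
    then have "(\<lambda>m. ?U (Suc m)) \<longlonglongrightarrow> 0"
      by (simp only: mult_zero_left mult_zero_right)
    then have "?U \<longlonglongrightarrow> 0"
      by (rule LIMSEQ_imp_Suc[where f = ?U])
    from telescope_sums'[OF this]
    have "(\<lambda>n. lebesgue_term q a n - (1 + a * q^4) * lebesgue_term q (a * q^4) n) sums 0"
      unfolding lebesgue_term_telescope[OF assms] by simp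
    moreover have "(\<lambda>n. lebesgue_term q a n - (1 + a * q^4) * lebesgue_term q (a * q^4) n) sums
        (L a - (1 + a * q^4) * L (a * q^4))"
      by (intro sums_diff sums_mult has_sum_imp_sums summ)
    ultimately show ?thesis
      using sums_unique2 by fastforce
  qed
  have iter: "L a = qpoch (- a * q^4) (q^4) m * L (a * (q^4) ^ m)" for m
  proof (induction m)
    case (Suc m)
    then show ?case
      using step[of "a * (q^4) ^ m"] by (simp add: qpoch_Suc mult_ac)
  qed simp
  have "(\<lambda>m. L (a * (q^4) ^ m)) \<longlonglongrightarrow> L 0"
  proof -
    obtain M where M: "M summable_on UNIV" "\<And>b n. norm b \<le> norm a \<Longrightarrow> norm (lebesgue_term q b n) \<le> M n"
      using lebesgue_term_bounded[OF assms] by blast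
    show ?thesis
      unfolding L_def
    proof (rule tendsto_infsum_dominated[OF _ _ M(1)])
      show "norm (lebesgue_term q (a * (q^4) ^ m) n) \<le> M n" for m n
      proof (rule M(2))
        have "norm a * norm (q^4) ^ m \<le> norm a * 1"
          using q4 by (intro mult_left_mono power_le_one) auto
        then show "norm (a * (q^4) ^ m) \<le> norm a" by (simp add: norm_mult norm_power)
      qed
      have "(\<lambda>m. a * (q^4) ^ m) \<longlonglongrightarrow> a * 0"
        by (intro tendsto_intros LIMSEQ_power_zero q4)
      then show "(\<lambda>m. lebesgue_term q (a * (q^4) ^ m) n) \<longlonglongrightarrow> lebesgue_term q 0 n" for n
        unfolding lebesgue_term_def qpoch_def
        by (intro tendsto_intros) simp_all
    qed
  qed
  then have "(\<lambda>m. qpoch (- a * q^4) (q^4) m * L (a * (q^4) ^ m)) \<longlonglongrightarrow> qpoch_inf (- a * q^4) (q^4) * L 0"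
    by (intro tendsto_mult qpoch_LIMSEQ q4)
  then have "L a = qpoch_inf (- a * q^4) (q^4) * L 0"
    unfolding iter[symmetric] by (simp add: LIMSEQ_const_iff)
  moreover have "L 0 = qpoch_inf (- (q^2)) (q^2)"
  proof (rule has_sum_unique[OF summ])
    have "lebesgue_term q 0 = (\<lambda>n. q ^ n * q ^ n\<^sup>2 * rqfac (q^2) (int n))"
      by (simp add: lebesgue_term_def fun_eq_iff power_add qpoch_def mult_ac)
    then show "(lebesgue_term q 0 has_sum qpoch_inf (- (q^2)) (q^2)) UNIV"
      using euler_q_exponential[OF assms assms(1)] by (simp add: power2_eq_square)
  qed
  ultimately show ?thesis
    using summ[of a] by (simp add: mult.commute)
qed

section \<open>The Goellnitz-Gordon identities\<close>

text \<open>
  Write \<open>Q = q\<^sup>2\<close>. Multiplying the kernel by \<open>1 - Q\<^sup>n\<^sup>+\<^sup>r\<close> turns it into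
  \<open>1 / ((Q;Q)\<^sub>n\<^sub>-\<^sub>r (Q;Q)\<^sub>n\<^sub>+\<^sub>r\<^sub>-\<^sub>1)\<close>, which is invariant under \<open>r \<mapsto> 1 - r\<close>, while
  \<open>(-1)\<^sup>r q powi (3 r\<^sup>2 - 3 r)\<close> changes sign. The difference of the two sides is therefore a sum equal to
  its own negative.
\<close>

lemma bailey_pair_step:
  fixes q :: complex
  assumes "q \<noteq> 0" "norm q < 1"
  shows "(\<Sum>r\<in>{- int n..int n}. (-1) powi r * q powi (3 * r\<^sup>2 - 3 * r) * bkernel (q^2) n r)
    = q ^ (2 * n) * (\<Sum>r\<in>{- int n..int n}. (-1) powi r * q powi (3 * r\<^sup>2 - r) * bkernel (q^2) n r)"
proof -
  let ?R = "rqfac (q^2)"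
  have q2: "norm (q^2) < 1" using assms by (simp add: norm_power power_less_one_iff)
  define c where "c r = (-1) powi r * q powi (3 * r\<^sup>2 - 3 * r)" for r :: int
  have a: "(-1) powi r * q powi (3 * r\<^sup>2 - r) = c r * q powi (2 * r)" for r
    using assms(1) by (simp add: c_def flip: power_int_add)
  have "c r * bkernel (q^2) n r - q ^ (2 * n) * (c r * q powi (2 * r) * bkernel (q^2) n r)
     = c r * (?R (int n - r) * ?R (int n + r - 1))" for r
  proof -
    have "?R (int n + r - 1) = (1 - (q^2) powi (int n + r)) * ?R (int n + r)"
      by (rule rqfac_rec[OF q2, symmetric])
    also have "(q^2) powi (int n + r) = q ^ (2 * n) * q powi (2 * r)"
      using assms(1) by (simp add: power_int_add power_int_mult power_mult)
    finally have 1: "?R (int n + r - 1) = (1 - q ^ (2 * n) * q powi (2 * r)) * ?R (int n + r)" .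
    show ?thesis unfolding 1 by (simp add: bkernel_def algebra_simps)
  qed
  then have "(\<Sum>r\<in>{- int n..int n}. c r * bkernel (q^2) n r)
      - q ^ (2 * n) * (\<Sum>r\<in>{- int n..int n}. c r * q powi (2 * r) * bkernel (q^2) n r)
      = (\<Sum>r\<in>{- int n..int n}. c r * (?R (int n - r) * ?R (int n + r - 1)))"
    by (simp only: sum_distrib_left sum_subtractf[symmetric])
  \<comment> \<open>The term at \<open>r = -n\<close> vanishes; dropping it makes the range invariant under \<open>r \<mapsto> 1 - r\<close>.\<close>
  also have "\<dots> = (\<Sum>r\<in>{1 - int n..int n}. c r * (?R (int n - r) * ?R (int n + r - 1)))"
    by (rule sum.mono_neutral_right) auto
  also have "\<dots> = 0"
  proof -
    let ?S = "\<Sum>r\<in>{1 - int n..int n}. c r * (?R (int n - r) * ?R (int n + r - 1))"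
    have c: "c (1 - r) = - c r" for r
    proof -
      have "(-1 :: complex) powi (1 - r) = - ((-1) powi r)"
        by (auto simp: power_int_minus_left)
      moreover have "3 * (1 - r)\<^sup>2 - 3 * (1 - r) = 3 * r\<^sup>2 - 3 * r"
        by (simp add: power2_eq_square algebra_simps)
      ultimately show ?thesis by (simp only: c_def) simp
    qed
    have "?S = (\<Sum>r\<in>{1 - int n..int n}. - (c r * (?R (int n - r) * ?R (int n + r - 1))))"
    proof (rule sum.reindex_bij_witness[where i = "\<lambda>r. 1 - r" and j = "\<lambda>r. 1 - r"])
      fix r
      show "- (c (1 - r) * (?R (int n - (1 - r)) * ?R (int n + (1 - r) - 1))) =
          c r * (?R (int n - r) * ?R (int n + r - 1))"
        unfolding c by (simp add: algebra_simps)
    qed auto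
    then have "?S = - ?S" by (simp only: sum_negf)
    then show ?thesis by simp
  qed
  finally show ?thesis unfolding a c_def[symmetric] by simp
qed

text \<open>
  The Bailey pair behind the first Goellnitz-Gordon identity (it is also the one behind the
  Rogers-Ramanujan identities). Induction on \<open>n\<close>: passing from \<open>n\<close> to \<open>n - 1\<close> multiplies the kernel by
  \<open>(1 - Q\<^sup>n\<^sup>-\<^sup>r)(1 - Q\<^sup>n\<^sup>+\<^sup>r) = 1 - Q\<^sup>n\<^sup>-\<^sup>r - Q\<^sup>n\<^sup>+\<^sup>r + Q\<^sup>2\<^sup>n\<close>. If \<open>A\<close> denotes the sum, the term with \<open>Q\<^sup>r\<close>
  sums to \<open>A\<close> again by \<open>r \<mapsto> -r\<close>, and the term with \<open>Q\<^sup>-\<^sup>r\<close> sums to \<open>Q\<^sup>n A\<close> by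
  \<open>bailey_pair_step\<close>; what is left is \<open>(1 - Q\<^sup>n) A\<close>.
\<close>

lemma bailey_pair_1:
  fixes q :: complex
  assumes "q \<noteq> 0" "norm q < 1"
  shows "(\<Sum>r\<in>{- int n..int n}. (-1) powi r * q powi (3 * r\<^sup>2 - r) * bkernel (q^2) n r) = rqfac (q^2) (int n)"
proof (induction n)
  case 0
  then show ?case by (simp add: bkernel_def)
next
  case (Suc n)
  let ?R = "rqfac (q^2)" and ?I = "{- int (Suc n)..int (Suc n)}"
  have q2: "norm (q^2) < 1" using assms by (simp add: norm_power power_less_one_iff)
  define K where "K = bkernel (q^2) (Suc n)"
  define a where "a r = (-1) powi r * q powi (3 * r\<^sup>2 - r)" for r :: int
  define Q where "Q = q ^ (2 * Suc n)"
  let ?A = "\<Sum>r\<in>?I. a r * K r"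
  have Q: "Q = (q^2) powi (int (Suc n))"
    by (simp only: Q_def power_int_of_nat power_mult)
  have K: "bkernel (q^2) n r = K r - Q * (q powi (- 2 * r) * K r) - Q * (q powi (2 * r) * K r) + Q * (Q * K r)" for r
  proof -
    have e1: "(q^2) powi (int (Suc n) - r) = Q * q powi (- 2 * r)"
    proof -
      have "(q^2) powi (int (Suc n) + (- r)) = Q * (q^2) powi (- r)"
        unfolding Q by (rule power_int_add) (use assms in simp)
      also have "(q^2) powi (- r) = q powi (2 * - r)"
        by (simp only: power_int_mult power_int_numeral)
      finally show ?thesis by simp
    qed
    have e2: "(q^2) powi (int (Suc n) + r) = Q * q powi (2 * r)"
    proof -
      have "(q^2) powi (int (Suc n) + r) = Q * (q^2) powi r"
        unfolding Q by (rule power_int_add) (use assms in simp)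
      also have "(q^2) powi r = q powi (2 * r)"
        by (simp only: power_int_mult power_int_numeral)
      finally show ?thesis .
    qed
    have e3: "q powi (- 2 * r) * q powi (2 * r) = 1"
      using assms(1) by (simp add: power_int_minus)
    have 1: "?R (int n - r) = (1 - Q * q powi (- 2 * r)) * ?R (int (Suc n) - r)"
      using rqfac_rec[OF q2, of "int (Suc n) - r"] unfolding e1 by (simp add: algebra_simps)
    have 2: "?R (int n + r) = (1 - Q * q powi (2 * r)) * ?R (int (Suc n) + r)"
      using rqfac_rec[OF q2, of "int (Suc n) + r"] unfolding e2 by (simp add: algebra_simps)
    have "bkernel (q^2) n r = (1 - Q * q powi (- 2 * r) - Q * q powi (2 * r) + Q * Q * (q powi (- 2 * r) * q powi (2 * r))) * K r"
      unfolding bkernel_def K_def 1 2 by (simp add: algebra_simps)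
    then show ?thesis unfolding e3 by (simp add: algebra_simps)
  qed
  have sB: "(\<Sum>r\<in>?I. a r * (q powi (- 2 * r) * K r)) = Q * ?A"
  proof -
    have "a r * q powi (- 2 * r) = (-1) powi r * q powi (3 * r\<^sup>2 - 3 * r)" for r
    proof -
      have "q powi (3 * r\<^sup>2 - r) * q powi (- 2 * r) = q powi (3 * r\<^sup>2 - r + - 2 * r)"
        by (rule power_int_add[symmetric]) (use assms in simp)
      then show ?thesis by (simp add: a_def algebra_simps)
    qed
    then show ?thesis
      using bailey_pair_step[OF assms, of "Suc n"]
      by (simp only: mult.assoc[symmetric] a_def[symmetric] K_def[symmetric] Q_def[symmetric])
  qed
  have sA: "(\<Sum>r\<in>?I. a r * (q powi (2 * r) * K r)) = ?A"
  proof (rule sum.reindex_bij_witness[where i = uminus and j = uminus])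
    fix r
    have "q powi (3 * r\<^sup>2 - r) * q powi (2 * r) = q powi (3 * r\<^sup>2 - r + 2 * r)"
      by (rule power_int_add[symmetric]) (use assms in simp)
    moreover have "(-1 :: complex) powi (- r) = (-1) powi r"
      by (simp add: power_int_minus_left)
    ultimately show "a (- r) * K (- r) = a r * (q powi (2 * r) * K r)"
      by (simp add: a_def K_def bkernel_minus add.commute)
  qed auto
  have "?R (int n) = (\<Sum>r\<in>{- int n..int n}. a r * bkernel (q^2) n r)"
    using Suc.IH by (simp only: a_def)
  also have "\<dots> = (\<Sum>r\<in>?I. a r * bkernel (q^2) n r)"
    by (rule sum.mono_neutral_left) (auto simp: bkernel_eq_0)
  also have "\<dots> = ?A - Q * (\<Sum>r\<in>?I. a r * (q powi (- 2 * r) * K r))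
      - Q * (\<Sum>r\<in>?I. a r * (q powi (2 * r) * K r)) + Q * (Q * ?A)"
    unfolding K sum_distrib_left sum_subtractf[symmetric] sum.distrib[symmetric]
    by (intro sum.cong refl) (simp only: algebra_simps)
  also have "\<dots> = (1 - Q) * ?A"
    unfolding sA sB by (simp add: algebra_simps)
  also have "?R (int n) = (1 - Q) * ?R (int (Suc n))"
    using rqfac_rec[OF q2, of "int (Suc n)"] unfolding Q by simp
  finally have "(1 - Q) * ?A = (1 - Q) * ?R (int (Suc n))" by (rule sym)
  moreover have "1 - Q \<noteq> 0"
    using one_minus_mult_power_nonzero[OF q2 q2, of n] unfolding Q_def power_mult power_Suc .
  ultimately have "?A = ?R (int (Suc n))"
    by (rule mult_left_cancel[THEN iffD1, rotated])
  then show ?case unfolding a_def K_def .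
qed

lemma bailey_pair_2:
  fixes q :: complex
  assumes "q \<noteq> 0" "norm q < 1"
  shows "(\<Sum>r\<in>{- int n..int n}. (-1) powi r * q powi (3 * r\<^sup>2 - 3 * r) * bkernel (q^2) n r)
      = q ^ (2 * n) * rqfac (q^2) (int n)"
  unfolding bailey_pair_step[OF assms] bailey_pair_1[OF assms] ..

text \<open>
  The weight against which the Bailey pairs are summed; Bailey's lemma supplies it when one of its
  parameters is \<open>-q\<close> and the other tends to infinity.
\<close>

definition gg_weight :: "complex \<Rightarrow> nat \<Rightarrow> complex" where
  "gg_weight q s = qpoch (- q) (q^2) s * q ^ s\<^sup>2"

lemma gg_weight_Suc: "gg_weight q (Suc s) = gg_weight q s * (q * q ^ (2 * s) * (1 + q * q ^ (2 * s)))"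
proof -
  have "(Suc s)\<^sup>2 = s\<^sup>2 + 2 * s + 1" by (simp add: power2_eq_square)
  then have "q ^ (Suc s)\<^sup>2 = q ^ s\<^sup>2 * (q * q ^ (2 * s))"
    by (simp only: power_add power_one_right mult_ac)
  moreover have "(q^2) ^ s = q ^ (2 * s)"
    by (simp only: power_mult)
  ultimately show ?thesis
    unfolding gg_weight_def qpoch_Suc by (simp only:) (simp add: mult_ac)
qed

lemma abs_summable_gg_weight:
  assumes "q \<noteq> 0" "norm q < 1"
  shows "gg_weight q abs_summable_on UNIV"
proof -
  have q2: "norm (q^2) < 1" using assms by (simp add: norm_power power_less_one_iff)
  obtain D where D: "\<And>n. norm (qpoch (- q) (q^2) n) \<le> D"
    using qpoch_bounded[OF q2] by blast
  have "(\<lambda>n. q ^ n\<^sup>2 * qpoch (- q) (q^2) n) abs_summable_on UNIV"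
  proof (rule abs_summable_on_mult_bounded)
    show "(\<lambda>n. q ^ n\<^sup>2) abs_summable_on UNIV"
      using abs_summable_quadratic_nat[OF assms, of 1 0] by (simp flip: of_nat_power)
  qed (rule D)
  then show ?thesis by (simp add: gg_weight_def[abs_def] mult.commute)
qed

lemma abs_summable_gg_weight_bkernel:
  assumes "q \<noteq> 0" "norm q < 1"
  shows "(\<lambda>s. gg_weight q s * bkernel (q^2) s r) abs_summable_on UNIV"
proof -
  have "norm (q^2) < 1" using assms by (simp add: norm_power power_less_one_iff)
  then obtain D where D: "\<And>s r. norm (bkernel (q^2) s r) \<le> D"
    using bkernel_bounded by blast
  show ?thesis
    by (rule abs_summable_on_mult_bounded[OF abs_summable_gg_weight[OF assms], where C = D]) (rule D)
qed

text \<open>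
  Creative telescoping: the difference of the two summands is \<open>1 - q\<^sup>2\<^sup>r\<^sup>+\<^sup>1\<close> times \<open>U s - U (s + 1)\<close>, where
  \<open>U s\<close> is the weight at \<open>s\<close> divided by \<open>(Q;Q)\<^sub>s\<^sub>-\<^sub>r\<^sub>-\<^sub>1 (Q;Q)\<^sub>s\<^sub>+\<^sub>r\<close>. Since \<open>U 0 = 0\<close> and \<open>U\<close> tends to \<open>0\<close>,
  nothing remains.
\<close>

lemma gg_weight_kernel_sum_step:
  fixes q :: complex and r :: nat
  assumes "q \<noteq> 0" "norm q < 1"
  shows "(\<Sum>\<^sub>\<infinity>s. gg_weight q s * bkernel (q^2) s (int (Suc r))) =
     q ^ (2 * r + 1) * (\<Sum>\<^sub>\<infinity>s. gg_weight q s * bkernel (q^2) s (int r))"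
proof -
  let ?R = "rqfac (q^2)"
  let ?f = "\<lambda>r s. gg_weight q s * bkernel (q^2) s (int r)"
  have q2: "norm (q^2) < 1" using assms by (simp add: norm_power power_less_one_iff)
  obtain C where C: "C > 0" "\<And>m. norm (?R m) \<le> C"
    using rqfac_bounded[OF q2] by blast
  have summ: "(?f r has_sum infsum (?f r) UNIV) UNIV" for r
    by (rule has_sum_infsum[OF abs_summable_summable[OF abs_summable_gg_weight_bkernel[OF assms]]])
  define U where "U s = gg_weight q s * (?R (int s - int r - 1) * ?R (int s + int r))" for s
  define y where "y = q ^ (2 * r)"
  have tele: "?f (Suc r) s - q ^ (2 * r + 1) * ?f r s = (1 - q * y) * (U s - U (Suc s))" for s
  proof -
    \<comment> \<open>With \<open>z = Q powi (s - r)\<close> and \<open>y = Q\<^sup>r\<close>, dividing by the common factors leaves a polynomial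
        identity in \<open>z\<close>, \<open>y\<close> and \<open>q\<close>.\<close>
    define R1 R2 z w where "R1 = ?R (int s - int r)" and "R2 = ?R (int s + int r + 1)"
      and "z = (q^2) powi (int s - int r)" and "w = gg_weight q s"
    have x: "q ^ (2 * s) = z * y"
    proof -
      have "z * y = (q^2) powi (int s - int r) * (q^2) powi (int r)"
        by (simp only: z_def y_def power_mult power_int_of_nat)
      also have "\<dots> = (q^2) powi (int s - int r + int r)"
        by (rule power_int_add[symmetric]) (use assms in simp)
      also have "\<dots> = q ^ (2 * s)"
        by (simp add: power_mult)
      finally show ?thesis by simp
    qed
    have 1: "?R (int s - int r - 1) = (1 - z) * R1"
      unfolding z_def R1_def by (rule rqfac_rec[OF q2, symmetric])
    have 2: "?R (int s + int r) = (1 - z * y * y * q^2) * R2"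
    proof -
      have "(q^2) powi (int s + int r + 1) = (q^2) ^ (s + r + 1)"
      proof -
        have "int s + int r + 1 = int (s + r + 1)" by simp
        then show ?thesis by (simp only: power_int_of_nat)
      qed
      also have "\<dots> = q ^ (2 * s) * y * q^2"
        by (simp add: y_def power_mult power_add)
      finally show ?thesis
        using rqfac_rec[OF q2, of "int s + int r + 1"] by (simp add: R2_def x)
    qed
    have f1: "?f (Suc r) s = w * ((1 - z) * R1 * R2)"
    proof -
      have i: "int s - int (Suc r) = int s - int r - 1" "int s + int (Suc r) = int s + int r + 1"
        by simp_all
      show ?thesis unfolding bkernel_def i 1 w_def R2_def ..
    qed
    have f0: "?f r s = w * (R1 * ((1 - z * y * y * q^2) * R2))"
      unfolding bkernel_def w_def 2 R1_def ..
    have U0: "U s = w * ((1 - z) * R1 * ((1 - z * y * y * q^2) * R2))"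
      unfolding U_def w_def 1 2 ..
    have U1: "U (Suc s) = w * (q * (z * y) * (1 + q * (z * y))) * (R1 * R2)"
      unfolding U_def gg_weight_Suc x w_def[symmetric] R1_def R2_def by (simp add: algebra_simps)
    have y: "q ^ (2 * r + 1) = q * y" by (simp add: y_def)
    show ?thesis
      unfolding f1 f0 U0 U1 y by (simp add: algebra_simps power2_eq_square)
  qed
  have U_lim: "U \<longlonglongrightarrow> 0"
  proof (rule Lim_null_comparison)
    show "eventually (\<lambda>s. norm (U s) \<le> norm (gg_weight q s) * (C * C)) sequentially"
      unfolding U_def norm_mult
      using C by (intro always_eventually allI mult_left_mono mult_mono) (auto intro: less_imp_le)
    have "(\<lambda>s. norm (gg_weight q s)) \<longlonglongrightarrow> 0"
      by (rule summable_LIMSEQ_zero[OF summable_on_imp_summable[OF abs_summable_gg_weight[OF assms]]])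
    then show "(\<lambda>s. norm (gg_weight q s) * (C * C)) \<longlonglongrightarrow> 0"
      by (rule tendsto_mult_left_zero)
  qed
  have "U 0 = 0" by (simp add: U_def)
  with sums_mult[OF telescope_sums'[OF U_lim], of "1 - q * y"]
  have "(\<lambda>s. ?f (Suc r) s - q ^ (2 * r + 1) * ?f r s) sums 0"
    unfolding tele by simp
  moreover have "(\<lambda>s. ?f (Suc r) s - q ^ (2 * r + 1) * ?f r s) sums
      (infsum (?f (Suc r)) UNIV - q ^ (2 * r + 1) * infsum (?f r) UNIV)"
    by (intro sums_diff sums_mult has_sum_imp_sums summ)
  ultimately show ?thesis
    using sums_unique2 by fastforce
qed

text \<open>
  By the preceding recurrence the sum equals \<open>q powi r\<^sup>2\<close> times a constant. The constant is found by
  letting \<open>r\<close> tend to infinity: the sum starts at \<open>s = r\<close>, and after substituting \<open>s = r + t\<close> and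
  dividing by \<open>q powi r\<^sup>2\<close> only the term \<open>t = 0\<close> survives in the limit.
\<close>

lemma gg_weight_kernel_sum_nat:
  fixes q :: complex and r :: nat
  assumes "q \<noteq> 0" "norm q < 1"
  shows "(\<Sum>\<^sub>\<infinity>s. gg_weight q s * bkernel (q^2) s (int r)) =
     q ^ r\<^sup>2 * (qpoch_inf (- q) (q^2) / qpoch_inf (q^2) (q^2))"
proof -
  let ?R = "rqfac (q^2)" and ?P = "qpoch_inf (- q) (q^2) / qpoch_inf (q^2) (q^2)"
  have q2: "norm (q^2) < 1" using assms by (simp add: norm_power power_less_one_iff)
  define L where "L r = (\<Sum>\<^sub>\<infinity>s. gg_weight q s * bkernel (q^2) s (int r))" for r
  have L: "L r = q ^ r\<^sup>2 * L 0" for r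
  proof (induction r)
    case (Suc r)
    have "(Suc r)\<^sup>2 = (2 * r + 1) + r\<^sup>2" by (simp add: power2_eq_square)
    then have "q ^ (Suc r)\<^sup>2 = q ^ (2 * r + 1) * q ^ r\<^sup>2"
      by (simp only: power_add)
    then show ?case
      using gg_weight_kernel_sum_step[OF assms, of r] Suc by (simp add: L_def)
  qed simp
  define g where "g r t = q ^ t\<^sup>2 * (q ^ (2 * r * t) * (qpoch (- q) (q^2) (r + t) * (?R (int t) * ?R (int (t + 2 * r)))))"
    for r t :: nat
  have Lg: "L r = q ^ r\<^sup>2 * infsum (g r) UNIV" for r
  proof -
    have "L r = (\<Sum>\<^sub>\<infinity>s\<in>range (\<lambda>t. r + t). gg_weight q s * bkernel (q^2) s (int r))"
      unfolding L_def
    proof (rule infsum_cong_neutral)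
      fix s assume "s \<in> UNIV - range (\<lambda>t. r + t)"
      then have "s < r"
        by (metis DiffD2 le_iff_add not_le rangeI)
      then show "gg_weight q s * bkernel (q^2) s (int r) = 0"
        by (simp add: bkernel_def)
    qed auto
    also have "\<dots> = (\<Sum>\<^sub>\<infinity>t. gg_weight q (r + t) * bkernel (q^2) (r + t) (int r))"
      by (subst infsum_reindex) (auto simp: o_def)
    also have "\<dots> = (\<Sum>\<^sub>\<infinity>t. q ^ r\<^sup>2 * g r t)"
    proof (rule infsum_cong)
      fix t
      have "(r + t)\<^sup>2 = r\<^sup>2 + (t\<^sup>2 + 2 * r * t)"
        by (simp add: power2_eq_square algebra_simps)
      then have "q ^ (r + t)\<^sup>2 = q ^ r\<^sup>2 * (q ^ t\<^sup>2 * q ^ (2 * r * t))"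
        by (simp only: power_add)
      then show "gg_weight q (r + t) * bkernel (q^2) (r + t) (int r) = q ^ r\<^sup>2 * g r t"
        by (simp add: gg_weight_def g_def bkernel_def algebra_simps)
    qed
    also have "\<dots> = q ^ r\<^sup>2 * infsum (g r) UNIV"
      by (rule infsum_cmult_right')
    finally show ?thesis .
  qed
  have g_inf: "infsum (g r) UNIV = L 0" for r
    using L[of r] Lg[of r] assms(1) by simp
  have "(\<lambda>r. infsum (g r) UNIV) \<longlonglongrightarrow> (\<Sum>\<^sub>\<infinity>t::nat. if t = 0 then ?P else 0)"
  proof -
    obtain C where C: "C > 0" "\<And>m. norm (?R m) \<le> C"
      using rqfac_bounded[OF q2] by blast
    obtain D where D: "D > 0" "\<And>n. norm (qpoch (- q) (q^2) n) \<le> D"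
      using qpoch_bounded[OF q2] by blast
    have bound: "norm (g r t) \<le> norm (q ^ t\<^sup>2) * (1 * (D * (C * C)))" for r t
      unfolding g_def norm_mult
      using C D less_imp_le[OF C(1)] less_imp_le[OF D(1)] assms(2)
      by (intro mult_left_mono mult_mono) (auto simp: norm_power power_le_one)
    show ?thesis
    proof (rule tendsto_infsum_dominated[where M = "\<lambda>t. norm (q ^ t\<^sup>2) * (1 * (D * (C * C)))"])
      show "norm (g r t) \<le> norm (q ^ t\<^sup>2) * (1 * (D * (C * C)))" for r t
        by (rule bound)
      show "(\<lambda>t. norm (q ^ t\<^sup>2) * (1 * (D * (C * C)))) summable_on UNIV"
        using abs_summable_quadratic_nat[OF assms, of 1 0]
        by (intro summable_on_cmult_left) (simp flip: of_nat_power)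
      fix t :: nat
      show "(\<lambda>r. g r t) \<longlonglongrightarrow> (if t = 0 then ?P else 0)"
      proof (cases "t = 0")
        case True
        have "(\<lambda>r. qpoch (- q) (q^2) r * ?R (int (2 * r))) \<longlonglongrightarrow> qpoch_inf (- q) (q^2) * (1 / qpoch_inf (q^2) (q^2))"
          using LIMSEQ_subseq_LIMSEQ[OF rqfac_LIMSEQ[OF q2], of "\<lambda>n. 2 * n"]
          by (intro tendsto_mult qpoch_LIMSEQ q2) (auto simp: strict_mono_def o_def)
        then show ?thesis using True by (simp add: g_def)
      next
        case False
        have "(\<lambda>r. g r t) \<longlonglongrightarrow> 0"
        proof (rule Lim_null_comparison)
          show "eventually (\<lambda>r. norm (g r t) \<le> norm q ^ r * (1 * (D * (C * C)))) sequentially"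
          proof (intro always_eventually allI)
            fix r
            have "norm (g r t) = norm (q ^ t\<^sup>2 * q ^ (2 * r * t)) * 
                (norm (qpoch (- q) (q^2) (r + t)) * (norm (?R (int t)) * norm (?R (int (t + 2 * r)))))"
              by (simp add: g_def norm_mult)
            also have "\<dots> \<le> norm q ^ r * (D * (C * C))"
            proof (intro mult_mono)
              have "r \<le> 2 * r * t" using False by (cases t) auto
              then have "r \<le> t\<^sup>2 + 2 * r * t" by (rule trans_le_add2)
              then have "norm q ^ (t\<^sup>2 + 2 * r * t) \<le> norm q ^ r"
                using assms(2) by (intro power_decreasing) auto
              then show "norm (q ^ t\<^sup>2 * q ^ (2 * r * t)) \<le> norm q ^ r"
                by (simp only: power_add[symmetric] norm_power)
            qed (use C D less_imp_le[OF C(1)] less_imp_le[OF D(1)] in auto)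
            finally show "norm (g r t) \<le> norm q ^ r * (1 * (D * (C * C)))" by simp
          qed
          show "(\<lambda>r. norm q ^ r * (1 * (D * (C * C)))) \<longlonglongrightarrow> 0"
            by (intro tendsto_mult_left_zero LIMSEQ_power_zero) (use assms in simp)
        qed
        then show ?thesis using False by simp
      qed
    qed
  qed
  moreover have "(\<Sum>\<^sub>\<infinity>t::nat. if t = 0 then ?P else 0) = ?P"
    by (subst infsum_cong_neutral[where T = "{0}" and g = "\<lambda>_. ?P"]) auto
  ultimately have "L 0 = ?P"
    unfolding g_inf by (simp add: LIMSEQ_const_iff)
  then show ?thesis using L[of r] by (simp add: L_def)
qed

lemma gg_weight_kernel_sum:
  fixes q :: complex and r :: int
  assumes "q \<noteq> 0" "norm q < 1"
  shows "((\<lambda>s. gg_weight q s * bkernel (q^2) s r) has_sum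
     q powi r\<^sup>2 * (qpoch_inf (- q) (q^2) / qpoch_inf (q^2) (q^2))) UNIV"
proof -
  have q2: "norm (q^2) < 1" using assms by (simp add: norm_power power_less_one_iff)
  define k where "k = nat \<bar>r\<bar>"
  have k: "r = int k \<or> r = - int k" by (auto simp: k_def)
  have "r\<^sup>2 = int (k\<^sup>2)" using k by auto
  then have e: "q powi r\<^sup>2 = q ^ k\<^sup>2" by (simp only: power_int_of_nat)
  have b: "bkernel (q^2) s r = bkernel (q^2) s (int k)" for s
    using k by (auto simp: bkernel_minus)
  have "((\<lambda>s. gg_weight q s * bkernel (q^2) s r) has_sum
      (\<Sum>\<^sub>\<infinity>s. gg_weight q s * bkernel (q^2) s r)) UNIV"
    by (rule has_sum_infsum[OF abs_summable_summable[OF abs_summable_gg_weight_bkernel[OF assms]]])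
  moreover have "(\<Sum>\<^sub>\<infinity>s. gg_weight q s * bkernel (q^2) s r) =
      q powi r\<^sup>2 * (qpoch_inf (- q) (q^2) / qpoch_inf (q^2) (q^2))"
    unfolding b e by (rule gg_weight_kernel_sum_nat[OF assms])
  ultimately show ?thesis by (simp only:)
qed

text \<open>
  Bailey's lemma in the one case used here: the double sum over \<open>r\<close> and \<open>s\<close> converges absolutely, so it
  may be summed over \<open>s\<close> first.
\<close>

lemma bailey_transform:
  fixes q :: complex and a :: "int \<Rightarrow> complex"
  assumes q: "q \<noteq> 0" "norm q < 1"
    and a: "a abs_summable_on UNIV"
    and \<theta>: "((\<lambda>r. a r * q powi r\<^sup>2) has_sum S) UNIV"
  shows "((\<lambda>s. gg_weight q s * (\<Sum>r\<in>{- int s..int s}. a r * bkernel (q^2) s r)) has_sum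
     S * (qpoch_inf (- q) (q^2) / qpoch_inf (q^2) (q^2))) UNIV"
proof -
  have q2: "norm (q^2) < 1" using q by (simp add: norm_power power_less_one_iff)
  let ?P = "qpoch_inf (- q) (q^2) / qpoch_inf (q^2) (q^2)"
  let ?F = "\<lambda>(r, s). a r * (gg_weight q s * bkernel (q^2) s r)"
  obtain D where "D > 0" and D: "\<And>s r. norm (bkernel (q^2) s r) \<le> D"
    by (rule bkernel_bounded[OF q2], rule that)
  have "(\<lambda>(r, s). a r * gg_weight q s) abs_summable_on UNIV \<times> UNIV"
    by (rule abs_summable_on_mult_Times[of a UNIV "gg_weight q" UNIV, OF a abs_summable_gg_weight[OF q]])
  then have "(\<lambda>x. (\<lambda>(r, s). a r * gg_weight q s) x * (\<lambda>(r, s). bkernel (q^2) s r) x) abs_summable_on UNIV \<times> UNIV"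
    by (rule abs_summable_on_mult_bounded[where f = "\<lambda>(r, s). a r * gg_weight q s" and C = D]) (auto simp: D)
  then have "?F abs_summable_on UNIV \<times> UNIV"
    by (simp add: case_prod_unfold mult.assoc)
  then have F: "?F summable_on UNIV \<times> UNIV"
    by (rule abs_summable_summable)
  have "(?F has_sum S * ?P) (UNIV \<times> UNIV)"
  proof (rule has_sum_SigmaI[OF _ _ F])
    show "((\<lambda>s. ?F (r, s)) has_sum a r * (q powi r\<^sup>2 * ?P)) UNIV" for r
      using has_sum_cmult_right[OF gg_weight_kernel_sum[OF q], of "a r"] by simp
    show "((\<lambda>r. a r * (q powi r\<^sup>2 * ?P)) has_sum S * ?P) UNIV"
      using has_sum_cmult_left[OF \<theta>, of ?P] by (simp add: mult.assoc)
  qed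
  then have "((\<lambda>(s, r). ?F (r, s)) has_sum S * ?P) (UNIV \<times> UNIV)"
    by (subst (asm) has_sum_swap)
  then show ?thesis
  proof (rule has_sum_SigmaD)
    fix s :: nat
    show "((\<lambda>r. case (s, r) of (s, r) \<Rightarrow> ?F (r, s)) has_sum
        gg_weight q s * (\<Sum>r\<in>{- int s..int s}. a r * bkernel (q^2) s r)) UNIV"
      by (rule has_sum_finite_neutralI[where B = "{- int s..int s}"])
         (auto simp: bkernel_eq_0 sum_distrib_left mult_ac)
  qed
qed

lemma minus_inverse_powi: "(- 1 / x) powi r = (-1) powi r * x powi (- r)" for x :: complex
proof -
  have "(- 1 / x) powi r = ((-1) * inverse x) powi r"
    by (simp add: divide_inverse)
  also have "\<dots> = (-1) powi r * inverse x powi r"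
    by (rule power_int_mult_distrib)
  finally show ?thesis
    by (simp add: power_int_inverse power_int_minus)
qed

text \<open>
  Cutting all products into residue classes modulo 8 displays the factors that cancel against the
  triple products below.
\<close>

lemma theta_prefactor:
  fixes q :: complex
  assumes "q \<noteq> 0" "norm q < 1"
  shows "qpoch_inf (- q) (q^2) / qpoch_inf (q^2) (q^2) =
    1 / (qpoch_inf q (q^8) * qpoch_inf (q^3) (q^8) * qpoch_inf (q^5) (q^8) * qpoch_inf (q^7) (q^8)
        * qpoch_inf (q^4) (q^8) * qpoch_inf (q^8) (q^8))"
proof -
  have n: "norm (q ^ k) < 1" if "k > 0" for k
    using assms that by (simp add: norm_power power_less_one_iff)
  have nz: "qpoch_inf (q ^ j) (q ^ k) \<noteq> 0" if "j > 0" "k > 0" for j k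
    using that by (intro qpoch_inf_nonzero n)
  have d: "qpoch_inf (q ^ j) (q ^ k) = qpoch_inf (q ^ j) (q ^ m) * qpoch_inf (q ^ l) (q ^ m)"
    if "j + k = l" "2 * k = m" "k > 0" for j k l m
    using qpoch_inf_dissect[OF n[OF that(3)], of "q ^ j"]
    by (simp add: power_add mult.commute flip: power_mult that(1,2))
  have "qpoch_inf q (q ^ 2) * qpoch_inf (- q) (q^2) = qpoch_inf (q ^ 2) (q ^ 4)"
    using qpoch_inf_mult_minus[OF n[of 2], of q] by (simp flip: power_mult)
  moreover have "qpoch_inf q (q ^ 2) = qpoch_inf q (q ^ 8) * qpoch_inf (q ^ 5) (q ^ 8)
       * (qpoch_inf (q ^ 3) (q ^ 8) * qpoch_inf (q ^ 7) (q ^ 8))"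
    using d[of 1 2 3 4] d[of 1 4 5 8] d[of 3 4 7 8] by simp
  moreover have "qpoch_inf (q ^ 2) (q ^ 2) = qpoch_inf (q ^ 2) (q ^ 4) * (qpoch_inf (q ^ 4) (q ^ 8) * qpoch_inf (q ^ 8) (q ^ 8))"
    using d[of 2 2 4 4] d[of 4 4 8 8] by simp
  ultimately show ?thesis
    using nz[of 1 2] nz[of 1 8] nz[of 2 4] nz[of 3 8] nz[of 5 8] nz[of 7 8] nz[of 4 8] nz[of 8 8]
    by (simp add: field_simps)
qed

theorem goellnitz_gordon_1:
  fixes q :: complex
  assumes "q \<noteq> 0" "norm q < 1"
  shows "((\<lambda>n. gg_weight q n * rqfac (q^2) (int n)) has_sum
     1 / (qpoch_inf q (q^8) * qpoch_inf (q^4) (q^8) * qpoch_inf (q^7) (q^8))) UNIV"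
proof -
  have n: "norm (q ^ k) < 1" if "k > 0" for k
    using assms that by (simp add: norm_power power_less_one_iff)
  have nz: "qpoch_inf (q ^ j) (q ^ 8) \<noteq> 0" if "j > 0" for j
    using that by (intro qpoch_inf_nonzero n) auto
  let ?a = "\<lambda>r::int. (-1) powi r * q powi (3 * r\<^sup>2 - r)"
  have a: "?a abs_summable_on UNIV"
    using abs_summable_quadratic[OF assms, of 3 "-1"] by (simp add: norm_mult norm_power_int)
  have "((\<lambda>r::int. (- 1 / q) powi r * (q^4) powi r\<^sup>2) has_sum
     qpoch_inf (- (- 1 / q) * q^4) ((q^4)\<^sup>2) * qpoch_inf (- (q^4) / (- 1 / q)) ((q^4)\<^sup>2) * qpoch_inf ((q^4)\<^sup>2) ((q^4)\<^sup>2)) UNIV"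
    by (rule jacobi_triple_product) (use assms n in auto)
  moreover have "(- 1 / q) powi r * (q^4) powi r\<^sup>2 = ?a r * q powi r\<^sup>2" for r
  proof -
    have "(- 1 / q) powi r = (-1) powi r * q powi (- r)"
      by (rule minus_inverse_powi)
    moreover have "(q^4) powi r\<^sup>2 = q powi (4 * r\<^sup>2)"
      by (simp only: power_int_mult power_int_numeral)
    moreover have "q powi (- r) * q powi (4 * r\<^sup>2) = q powi (3 * r\<^sup>2 - r) * q powi r\<^sup>2"
      using assms(1) by (simp flip: power_int_add)
    ultimately show ?thesis by simp
  qed
  moreover have "- (- 1 / q) * q^4 = q^3" "- (q^4) / (- 1 / q) = q^5" "(q^4)\<^sup>2 = q^8"
    using assms(1) by (simp_all add: power_numeral_reduce)
  ultimately have "((\<lambda>r. ?a r * q powi r\<^sup>2) has_sum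
      qpoch_inf (q^3) (q^8) * qpoch_inf (q^5) (q^8) * qpoch_inf (q^8) (q^8)) UNIV"
    by (simp only:)
  from bailey_transform[OF assms a this]
  show ?thesis
    unfolding bailey_pair_1[OF assms] theta_prefactor[OF assms]
    using nz[of 3] nz[of 5] nz[of 8] by (simp add: field_simps)
qed

theorem goellnitz_gordon_2:
  fixes q :: complex
  assumes "q \<noteq> 0" "norm q < 1"
  shows "((\<lambda>n. gg_weight q n * (q ^ (2 * n) * rqfac (q^2) (int n))) has_sum
     1 / (qpoch_inf (q^3) (q^8) * qpoch_inf (q^4) (q^8) * qpoch_inf (q^5) (q^8))) UNIV"
proof -
  have n: "norm (q ^ k) < 1" if "k > 0" for k
    using assms that by (simp add: norm_power power_less_one_iff)
  have nz: "qpoch_inf (q ^ j) (q ^ 8) \<noteq> 0" if "j > 0" for j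
    using that by (intro qpoch_inf_nonzero n) auto
  let ?a = "\<lambda>r::int. (-1) powi r * q powi (3 * r\<^sup>2 - 3 * r)"
  have a: "?a abs_summable_on UNIV"
    using abs_summable_quadratic[OF assms, of 3 "-3"] by (simp add: norm_mult norm_power_int)
  have "((\<lambda>r::int. (- 1 / q^3) powi r * (q^4) powi r\<^sup>2) has_sum
     qpoch_inf (- (- 1 / q^3) * q^4) ((q^4)\<^sup>2) * qpoch_inf (- (q^4) / (- 1 / q^3)) ((q^4)\<^sup>2) * qpoch_inf ((q^4)\<^sup>2) ((q^4)\<^sup>2)) UNIV"
    by (rule jacobi_triple_product) (use assms n in auto)
  moreover have "(- 1 / q^3) powi r * (q^4) powi r\<^sup>2 = ?a r * q powi r\<^sup>2" for r
  proof -
    have "(q^3) powi r = q powi (3 * r)"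
      by (simp only: power_int_mult power_int_numeral)
    then have "(- 1 / q^3) powi r = (-1) powi r * q powi (- (3 * r))"
      unfolding minus_inverse_powi by (simp add: power_int_minus)
    moreover have "(q^4) powi r\<^sup>2 = q powi (4 * r\<^sup>2)"
      by (simp only: power_int_mult power_int_numeral)
    moreover have "q powi (- (3 * r)) * q powi (4 * r\<^sup>2) = q powi (3 * r\<^sup>2 - 3 * r) * q powi r\<^sup>2"
      using assms(1) by (simp flip: power_int_add)
    ultimately show ?thesis by simp
  qed
  moreover have "- (- 1 / q^3) * q^4 = q" "- (q^4) / (- 1 / q^3) = q^7" "(q^4)\<^sup>2 = q^8"
    using assms(1) by (simp_all add: power_numeral_reduce)
  ultimately have "((\<lambda>r. ?a r * q powi r\<^sup>2) has_sum
      qpoch_inf q (q^8) * qpoch_inf (q^7) (q^8) * qpoch_inf (q^8) (q^8)) UNIV"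
    by (simp only:)
  from bailey_transform[OF assms a this]
  show ?thesis
    unfolding bailey_pair_2[OF assms] theta_prefactor[OF assms]
    using nz[of 1] nz[of 7] nz[of 8] by (simp add: field_simps)
qed

section \<open>Reduction of the triple sum to a single sum\<close>

text \<open>
  With \<open>n = j + 2 k\<close> and \<open>N = i + n\<close> the quadratic form is \<open>N\<^sup>2 + n\<^sup>2 + j\<^sup>2\<close>, and the linear coefficients
  \<open>a\<close>, \<open>a + d - 1\<close>, \<open>2 a + 2 d\<close> are those for which the linear part is \<open>a N + d n - j\<close>. All five
  identities are of this type.
\<close>

lemma summand_factorization:
  fixes q :: complex and a d :: int and i j k :: nat
  assumes "q \<noteq> 0"
  defines "n \<equiv> int j + 2 * int k"
  shows "summand q a (a + d - 1) (2 * a + 2 * d) (i, j, k) =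
     q powi ((int i + n)\<^sup>2 + a * (int i + n)) * (q powi (n\<^sup>2 + d * n) * q powi ((int j)\<^sup>2 - int j)) *
     (rqfac (q^2) (int i) * (rqfac (q^2) (int j) * rqfac (q^4) (int k)))"
proof -
  have e: "(int i)\<^sup>2 + 3 * (int j)\<^sup>2 + 8 * (int k)\<^sup>2 + 2 * int i * int j + 4 * int i * int k + 8 * int j * int k
        + a * int i + (a + d - 1) * int j + (2 * a + 2 * d) * int k
      = ((int i + n)\<^sup>2 + a * (int i + n)) + ((n\<^sup>2 + d * n) + ((int j)\<^sup>2 - int j))"
    by (simp add: n_def power2_eq_square algebra_simps)
  note add = power_int_add[OF disjI1[OF assms(1)]]
  have p: "q powi (((int i + n)\<^sup>2 + a * (int i + n)) + ((n\<^sup>2 + d * n) + ((int j)\<^sup>2 - int j))) =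
      q powi ((int i + n)\<^sup>2 + a * (int i + n)) * (q powi (n\<^sup>2 + d * n) * q powi ((int j)\<^sup>2 - int j))"
    by (simp only: add[of "(int i + n)\<^sup>2 + a * (int i + n)"] add[of "n\<^sup>2 + d * n"])
  show ?thesis
    unfolding summand_def prod.case e p rqfac_of_nat by simp
qed

text \<open>
  The map \<open>(i, j, k) \<mapsto> (N, n, j)\<close> is injective and the three powers of \<open>q\<close> depend on one new variable
  each, so the sum of norms is dominated by a product of three convergent sums.
\<close>

lemma abs_summable_summand:
  fixes q :: complex and a d :: int
  assumes "q \<noteq> 0" "norm q < 1"
  shows "summand q a (a + d - 1) (2 * a + 2 * d) abs_summable_on UNIV"
proof -
  define E where "E b n = q powi (int 1 * (int n)\<^sup>2 + b * int n)" for b :: int and n :: nat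
  define H where "H = (\<lambda>(N, n, j). E a N * (E d n * E (-1) j))"
  define \<phi> :: "nat \<times> nat \<times> nat \<Rightarrow> nat \<times> nat \<times> nat" where "\<phi> = (\<lambda>(i, j, k). (i + (j + 2 * k), j + 2 * k, j))"
  define R where "R = (\<lambda>(i, j, k). rqfac (q^2) (int i) * (rqfac (q^2) (int j) * rqfac (q^4) (int k)))"
  have E: "E b abs_summable_on UNIV" for b
    unfolding E_def[abs_def] by (rule abs_summable_quadratic_nat) (use assms in auto)
  have "(\<lambda>(n, j). E d n * E (-1) j) abs_summable_on UNIV \<times> UNIV"
    by (rule abs_summable_on_mult_Times[OF E E])
  from abs_summable_on_mult_Times[OF E[of a] this]
  have "H abs_summable_on UNIV"
    by (simp add: H_def case_prod_unfold)
  then have "(\<lambda>x. norm (H x)) summable_on range \<phi>"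
    by (rule summable_on_subset) auto
  moreover have "inj \<phi>"
    by (auto simp: \<phi>_def inj_def)
  ultimately have H\<phi>: "(\<lambda>x. H (\<phi> x)) abs_summable_on UNIV"
    by (subst (asm) summable_on_reindex) (simp_all add: o_def)
  have q2: "norm (q^2) < 1" and q4: "norm (q^4) < 1"
    using assms by (simp_all add: norm_power power_less_one_iff)
  obtain C where "C > 0" and C: "\<And>m. norm (rqfac (q^2) m) \<le> C"
    by (rule rqfac_bounded[OF q2], rule that)
  obtain D where "D > 0" and D: "\<And>m. norm (rqfac (q^4) m) \<le> D"
    by (rule rqfac_bounded[OF q4], rule that)
  have R: "norm (R x) \<le> C * (C * D)" for x
    unfolding R_def case_prod_unfold norm_mult
    using \<open>C > 0\<close> \<open>D > 0\<close> by (intro mult_mono C D) auto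
  have "(\<lambda>x. H (\<phi> x) * R x) abs_summable_on UNIV"
    by (rule abs_summable_on_mult_bounded[OF H\<phi>, where C = "C * (C * D)"]) (rule R)
  moreover have "summand q a (a + d - 1) (2 * a + 2 * d) = (\<lambda>x. H (\<phi> x) * R x)"
  proof (intro ext)
    fix x :: "nat \<times> nat \<times> nat"
    obtain i j k where x: "x = (i, j, k)" by (cases x)
    show "summand q a (a + d - 1) (2 * a + 2 * d) x = H (\<phi> x) * R x"
      unfolding x summand_factorization[OF assms(1)]
      by (simp add: H_def \<phi>_def R_def E_def)
  qed
  ultimately show ?thesis by (simp only:)
qed

text \<open>
  For fixed \<open>N\<close> the sum over \<open>k\<close> is \<open>1/(q\<^sup>2;q\<^sup>2)\<^sub>n\<close> by \<open>rqfac_even_odd_sum\<close>, and the remaining sum over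
  \<open>n\<close> is the finite q-binomial theorem at \<open>x = q\<^sup>d\<close>.
\<close>

lemma inner_double_sum:
  fixes q :: complex and d :: int
  assumes "q \<noteq> 0" "norm q < 1"
  shows "((\<lambda>(n, k). rqfac (q^2) (int N - int n) * (q powi ((int n)\<^sup>2 + d * int n) *
       (q powi ((int n - 2 * int k)\<^sup>2 - (int n - 2 * int k)) *
            (rqfac (q^2) (int n - 2 * int k) * rqfac (q^4) (int k))))) has_sum
     qpoch (- (q powi (1 + d))) (q^2) N * rqfac (q^2) (int N)) UNIV"
    (is "(?f has_sum _) _")
proof (rule has_sum_finite_neutralI[where B = "SIGMA n:{..N}. {..n}"])
  show "finite (SIGMA n:{..N}. {..n})" by auto
  fix x :: "nat \<times> nat" assume "x \<in> UNIV - (SIGMA n:{..N}. {..n})"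
  then show "?f x = 0" by (cases x) auto
next
  have "qpoch (- (q powi (1 + d))) (q^2) N * rqfac (q^2) (int N) =
      (\<Sum>n\<le>N. (q powi d) ^ n * q ^ n\<^sup>2 * (rqfac (q^2) (int n) * rqfac (q^2) (int N - int n)))"
    using qbinomial_sum[OF assms(2), where x = "q powi d"] assms(1)
    by (simp add: power_int_add mult.commute)
  also have "\<dots> = (\<Sum>n\<le>N. \<Sum>k\<le>n. ?f (n, k))"
  proof (intro sum.cong refl)
    fix n
    have "(q powi d) ^ n * q ^ n\<^sup>2 = q powi (d * int n) * q powi (int (n\<^sup>2))"
      by (simp only: power_int_mult power_int_of_nat)
    also have "\<dots> = q powi ((int n)\<^sup>2 + d * int n)"
      using assms(1) by (simp add: power_int_add)
    finally have e: "(q powi d) ^ n * q ^ n\<^sup>2 = q powi ((int n)\<^sup>2 + d * int n)" .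
    show "(q powi d) ^ n * q ^ n\<^sup>2 * (rqfac (q^2) (int n) * rqfac (q^2) (int N - int n)) = (\<Sum>k\<le>n. ?f (n, k))"
      unfolding e rqfac_even_odd_sum[OF assms, of n, symmetric] prod.case
      by (simp only: sum_distrib_left sum_distrib_right mult_ac)
  qed
  also have "\<dots> = (\<Sum>x\<in>(SIGMA n:{..N}. {..n}). ?f x)"
    by (subst sum.Sigma) (auto simp: case_prod_unfold)
  finally show "qpoch (- (q powi (1 + d))) (q^2) N * rqfac (q^2) (int N) = (\<Sum>x\<in>(SIGMA n:{..N}. {..n}). ?f x)" .
qed auto

theorem triple_sum_reduction:
  fixes q :: complex and a d :: int
  assumes q: "q \<noteq> 0" "norm q < 1"
    and S: "((\<lambda>N. q powi ((int N)\<^sup>2 + a * int N) *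
        (qpoch (- (q powi (1 + d))) (q^2) N * rqfac (q^2) (int N))) has_sum S) UNIV"
  shows "(summand q a (a + d - 1) (2 * a + 2 * d) has_sum S) UNIV"
proof -
  let ?s = "summand q a (a + d - 1) (2 * a + 2 * d)"
  define f where "f N = (\<lambda>(n, k). rqfac (q^2) (int N - int n) * (q powi ((int n)\<^sup>2 + d * int n) *
       (q powi ((int n - 2 * int k)\<^sup>2 - (int n - 2 * int k)) *
            (rqfac (q^2) (int n - 2 * int k) * rqfac (q^4) (int k)))))" for N :: nat
  define g where "g = (\<lambda>(N, p). q powi ((int N)\<^sup>2 + a * int N) * f N p)"
  define T :: "(nat \<times> nat \<times> nat) set" where "T = {(N, n, k). n \<le> N \<and> 2 * k \<le> n}"
  obtain S' where S': "(?s has_sum S') UNIV"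
    using has_sum_infsum[OF abs_summable_summable[OF abs_summable_summand[OF q]]] by blast
  also have "(?s has_sum S') UNIV \<longleftrightarrow> (g has_sum S') T"
  proof (rule has_sum_reindex_bij_witness[where i = "\<lambda>(N, n, k). (N - n, n - 2 * k, k)"
        and j = "\<lambda>(i, j, k). (i + (j + 2 * k), j + 2 * k, k)"])
    fix x :: "nat \<times> nat \<times> nat"
    obtain i j k where x: "x = (i, j, k)" by (cases x)
    show "g ((\<lambda>(i, j, k). (i + (j + 2 * k), j + 2 * k, k)) x) = ?s x"
      unfolding x summand_factorization[OF q(1)]
      by (simp add: g_def f_def mult_ac)
  qed (auto simp: T_def)
  also have "(g has_sum S') T \<longleftrightarrow> (g has_sum S') (UNIV \<times> UNIV)"
  proof (rule has_sum_cong_neutral)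
    fix x assume x: "x \<in> UNIV \<times> UNIV - T"
    obtain N n k where "x = (N, n, k)" by (cases x)
    with x have "int N - int n < 0 \<or> int n - 2 * int k < 0"
      by (auto simp: T_def)
    then have "rqfac (q^2) (int N - int n) * rqfac (q^2) (int n - 2 * int k) = 0"
      by (auto simp del: diff_less_0_iff_less)
    then show "g x = 0"
      using \<open>x = (N, n, k)\<close> by (auto simp: g_def f_def)
  qed auto
  finally have "((\<lambda>N. q powi ((int N)\<^sup>2 + a * int N) *
        (qpoch (- (q powi (1 + d))) (q^2) N * rqfac (q^2) (int N))) has_sum S') UNIV"
  proof (rule has_sum_SigmaD)
    fix N :: nat
    show "((\<lambda>p. g (N, p)) has_sum q powi ((int N)\<^sup>2 + a * int N) *
        (qpoch (- (q powi (1 + d))) (q^2) N * rqfac (q^2) (int N))) UNIV"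
      unfolding g_def f_def prod.case by (intro has_sum_cmult_right inner_double_sum q)
  qed
  then have "S' = S"
    by (rule has_sum_unique[OF _ S])
  then show ?thesis
    using S' by (simp only:)
qed

text \<open>
  For \<open>a = 1\<close> the single sum is Lebesgue's series with parameter \<open>q\<^sup>d\<^sup>-\<^sup>1\<close>.
\<close>

lemma triple_sum_lebesgue:
  fixes q :: complex and d :: int
  assumes q: "q \<noteq> 0" "norm q < 1"
  shows "(summand q 1 d (2 + 2 * d) has_sum
     qpoch_inf (- (q^2)) (q^2) * qpoch_inf (- (q powi (3 + d))) (q^4)) UNIV"
proof -
  have "(lebesgue_term q (q powi (d - 1)) has_sum
      qpoch_inf (- (q^2)) (q^2) * qpoch_inf (- (q powi (d - 1)) * q^4) (q^4)) UNIV"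
    by (rule lebesgue_identity[OF q])
  moreover have "q powi (d - 1) * q^2 = q powi (1 + d)" "q powi (d - 1) * q^4 = q powi (3 + d)"
    using q(1) by (simp_all add: power_int_add power_int_diff power_numeral_reduce field_simps)
  moreover have "q ^ (N\<^sup>2 + N) = q powi ((int N)\<^sup>2 + 1 * int N)" for N
    by (simp flip: power_int_of_nat)
  ultimately have "((\<lambda>N. q powi ((int N)\<^sup>2 + 1 * int N) *
        (qpoch (- (q powi (1 + d))) (q^2) N * rqfac (q^2) (int N))) has_sum
      qpoch_inf (- (q^2)) (q^2) * qpoch_inf (- (q powi (3 + d))) (q^4)) UNIV"
    by (simp only: lebesgue_term_def[abs_def] minus_mult_left[symmetric])
  from triple_sum_reduction[OF q this] show ?thesis
    by (simp add: algebra_simps)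
qed

section \<open>The five identities\<close>

theorem theorem3p9:
  fixes q :: complex
  assumes "0 < norm q" and "norm q < 1"
  shows "(summand q 0 (-1) 0 has_sum 1 / qpoch_inf_list [q, q^4, q^7] (q^8)) UNIV
    \<and> (summand q 1 (-3) (-4) has_sum 2 * (qpoch_inf (q^8) (q^8) / qpoch_inf (q^2) (q^2))) UNIV
    \<and> (summand q 1 (-1) 0 has_sum
          qpoch_inf (q^4) (q^4) ^ 3 / (qpoch_inf (q^2) (q^2) ^ 2 * qpoch_inf (q^8) (q^8))) UNIV
    \<and> (summand q 1 1 4 has_sum qpoch_inf (q^8) (q^8) / qpoch_inf (q^2) (q^2)) UNIV
    \<and> (summand q 2 1 4 has_sum 1 / qpoch_inf_list [q^3, q^4, q^5] (q^8)) UNIV"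
proof -
  \<comment> \<open>The pairs \<open>(a, d)\<close> are \<open>(0, 0)\<close>, \<open>(1, -3)\<close>, \<open>(1, -1)\<close>, \<open>(1, 1)\<close> and \<open>(2, 0)\<close>: the first and last
      belong to Goellnitz-Gordon, the others to Lebesgue.\<close>
  have q: "q \<noteq> 0" "norm q < 1" using assms by auto
  have n: "norm (q ^ k) < 1" if "k > 0" for k
    using assms that by (simp add: norm_power power_less_one_iff)
  have nz: "qpoch_inf (q ^ j) (q ^ k) \<noteq> 0" if "j > 0" "k > 0" for j k
    using that by (intro qpoch_inf_nonzero n)
  have m2: "qpoch_inf (- (q^2)) (q^2) = qpoch_inf (q^4) (q^4) / qpoch_inf (q^2) (q^2)"
    using qpoch_inf_mult_minus[OF n[of 2], of "q^2"] nz[of 2 2]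
    by (simp add: field_simps flip: power_mult)
  have m4: "qpoch_inf (- (q^4)) (q^4) = qpoch_inf (q^8) (q^8) / qpoch_inf (q^4) (q^4)"
    using qpoch_inf_mult_minus[OF n[of 4], of "q^4"] nz[of 4 4]
    by (simp add: field_simps flip: power_mult)
  have odd: "qpoch_inf (- (q^2)) (q^4) = qpoch_inf (q^4) (q^4) ^ 2 / (qpoch_inf (q^2) (q^2) * qpoch_inf (q^8) (q^8))"
  proof -
    have "qpoch_inf (- (q^2)) (q^2) = qpoch_inf (- (q^2)) (q^4) * qpoch_inf (- (q^4)) (q^4)"
      using qpoch_inf_dissect[OF n[of 2], of "- (q^2)"] by (simp flip: power_mult power_add)
    then show ?thesis
      unfolding m2 m4 using nz[of 4 4] nz[of 8 8] nz[of 2 2] by (simp add: field_simps power2_eq_square)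
  qed
  \<comment> \<open>The vanishing exponent \<open>3 + d = 0\<close> for \<open>d = -3\<close> is the origin of the factor 2.\<close>
  have one: "qpoch_inf (- 1) (q^4) = 2 * qpoch_inf (- (q^4)) (q^4)"
    using qpoch_inf_rec[OF n[of 4], of "-1"] by simp
  have "((\<lambda>N. q powi ((int N)\<^sup>2 + 0 * int N) *
        (qpoch (- (q powi (1 + 0))) (q^2) N * rqfac (q^2) (int N))) has_sum
          1 / (qpoch_inf q (q^8) * qpoch_inf (q^4) (q^8) * qpoch_inf (q^7) (q^8))) UNIV"
  proof -
    have "q powi ((int N)\<^sup>2 + 0 * int N) = q ^ N\<^sup>2" for N
      by (simp flip: power_int_of_nat)
    then show ?thesis
      using goellnitz_gordon_1[OF q] by (simp add: gg_weight_def mult_ac)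
  qed
  from triple_sum_reduction[OF q this]
  have 1: "(summand q 0 (-1) 0 has_sum 1 / qpoch_inf_list [q, q^4, q^7] (q^8)) UNIV"
    by (simp add: qpoch_inf_list_def mult_ac)
  have "((\<lambda>N. q powi ((int N)\<^sup>2 + 2 * int N) *
        (qpoch (- (q powi (1 + 0))) (q^2) N * rqfac (q^2) (int N))) has_sum
          1 / (qpoch_inf (q^3) (q^8) * qpoch_inf (q^4) (q^8) * qpoch_inf (q^5) (q^8))) UNIV"
  proof -
    have "q powi ((int N)\<^sup>2 + 2 * int N) = q ^ N\<^sup>2 * q ^ (2 * N)" for N
      using power_int_of_nat[of q "N\<^sup>2 + 2 * N"] by (simp add: power_add)
    then show ?thesis
      using goellnitz_gordon_2[OF q] by (simp add: gg_weight_def mult_ac)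
  qed
  from triple_sum_reduction[OF q this]
  have 5: "(summand q 2 1 4 has_sum 1 / qpoch_inf_list [q^3, q^4, q^5] (q^8)) UNIV"
    by (simp add: qpoch_inf_list_def mult_ac)
  have 2: "(summand q 1 (-3) (-4) has_sum 2 * (qpoch_inf (q^8) (q^8) / qpoch_inf (q^2) (q^2))) UNIV"
    using triple_sum_lebesgue[OF q, of "-3"] nz[of 4 4]
    by (simp add: one m2 m4)
  have 3: "(summand q 1 (-1) 0 has_sum
          qpoch_inf (q^4) (q^4) ^ 3 / (qpoch_inf (q^2) (q^2) ^ 2 * qpoch_inf (q^8) (q^8))) UNIV"
  proof -
    have "qpoch_inf (- (q^2)) (q^2) * qpoch_inf (- (q^2)) (q^4) =
        qpoch_inf (q^4) (q^4) ^ 3 / (qpoch_inf (q^2) (q^2) ^ 2 * qpoch_inf (q^8) (q^8))"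
      unfolding m2 odd by (simp add: power_numeral_reduce)
    then show ?thesis
      using triple_sum_lebesgue[OF q, of "-1"] by simp
  qed
  have 4: "(summand q 1 1 4 has_sum qpoch_inf (q^8) (q^8) / qpoch_inf (q^2) (q^2)) UNIV"
    using triple_sum_lebesgue[OF q, of 1] nz[of 4 4]
    by (simp add: m2 m4)
  from 1 2 3 4 5 show ?thesis by blast
qed

end
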